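(* Let $w \in C_2$. The following are equivalent. (1) $w$ is a root word. (2) $|(ab)_w - (a\overline{b})_w| = (aa)_w = (bb)_w$. (3) $|(yx)_w - (y\overline{x})_w| = (yy)_w = (xx)_w$ for some $x, y \in L_2$ with $x \notin \{y,\overline{y}\}$.
   Context: $F_2$ is the free group on generators $a,b$; $\overline{x}$ denotes the inverse of $x$ (so $\overline{\overline{x}}=x$), and $L_2=\{a,b,\overline{a},\overline{b}\}$ is the set of letters. Each element of $F_2$ is identified with its word over $L_2$ with no adjacent inverses, and $|w|$ is the length of that word. $C_2$ is the set of words $w=w_1\cdots w_\ell\in F_2$ such that $w_\ell\neq\overline{w_1}$. A word $w\in F_2$ is minimal if $|w|\le|\phi(w)|$ for all $\phi\in\operatorname{Aut}F_2$. Subword counts: if $w=w_1\cdots w_\ell$ and $v$ are nonempty words on $L_2$ with $k=|v|\le|w|=\ell$, then $[v]_w$ is the number of (possibly overlapping) occurrences of the contiguous subword $v$ in $w_1\cdots w_\ell w_1\cdots w_{k-1}$; if $|v|>|w|$, then $[v]_w=0$. Set $(v)_w=[v]_w+[v^{-1}]_w$. Child: for a nonempty word $w=w_1\cdots w_\ell\in C_2$ and $1\le i\le\ell$, the word $w_1\cdots w_{i-1}w_iw_iw_{i+1}\cdots w_\ell$ obtained by duplicating the letter $w_i$ is a child of $w$. In addition, each letter $x\in L_2$ is a child of the empty word. A root word is a minimal word that is not a child of any minimal word.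
   Formalization: As stated, (2)⇒(1) fails for single letters and (1)⇒(2) fails e.g. for w = babāb. Proved: (1)⇔(2) if w is empty or its first and last letters differ; for |w|≠1, (2) holds iff every rotation of w is a root word; (2)⇔(3) for all w. *)

theory Defs
  imports "HOL-Algebra.Bij"
begin

datatype letter = A | A_inv | B | B_inv

fun bar :: "letter \<Rightarrow> letter" where
  "bar A = A_inv"
| "bar A_inv = A"
| "bar B = B_inv"
| "bar B_inv = B"

lemma bar_bar [simp]: "bar (bar x) = x"
  by (cases x) auto

definition reduced :: "letter list \<Rightarrow> bool" where
  "reduced w \<longleftrightarrow> successively (\<lambda>x y. y \<noteq> bar x) w"

text \<open>Left multiplication of a reduced word by a single letter, with cancellation.\<close>

fun cons_red :: "letter \<Rightarrow> letter list \<Rightarrow> letter list" where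
  "cons_red x [] = [x]"
| "cons_red x (y # ys) = (if y = bar x then ys else x # y # ys)"

definition F2 :: "letter list monoid" where
  "F2 = \<lparr>carrier = {w. reduced w}, mult = (\<lambda>u v. foldr cons_red u v), one = []\<rparr>"

definition word_inv :: "letter list \<Rightarrow> letter list" where
  "word_inv w = map bar (rev w)"

definition C2 :: "letter list set" where
  "C2 = {w. reduced w \<and> (w \<noteq> [] \<longrightarrow> last w \<noteq> bar (hd w))}"

definition minimal :: "letter list \<Rightarrow> bool" where
  "minimal w \<longleftrightarrow> w \<in> carrier F2 \<and> (\<forall>\<phi> \<in> auto F2. length w \<le> length (\<phi> w))"

definition occurrences :: "letter list \<Rightarrow> letter list \<Rightarrow> nat" where
  "occurrences v u = card {i. i + length v \<le> length u \<and> take (length v) (drop i u) = v}"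

text \<open>The counts \<open>[v]\<^sub>w\<close> and \<open>(v)\<^sub>w\<close>, for nonempty \<open>v\<close>.\<close>

definition subword_count :: "letter list \<Rightarrow> letter list \<Rightarrow> nat" where
  "subword_count v w =
     (if length v \<le> length w then occurrences v (w @ take (length v - 1) w) else 0)"

definition sym_count :: "letter list \<Rightarrow> letter list \<Rightarrow> nat" where
  "sym_count v w = subword_count v w + subword_count (word_inv v) w"

text \<open>\<open>is_child v u\<close> says that \<open>v\<close> is a child of \<open>u\<close>. As lists are indexed from 0,
  \<open>take (Suc i) u @ drop i u\<close> duplicates the letter \<open>u ! i\<close>.\<close>

definition is_child :: "letter list \<Rightarrow> letter list \<Rightarrow> bool" where
  "is_child v u \<longleftrightarrow>
     (u = [] \<and> (\<exists>x. v = [x])) \<or>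
     (u \<noteq> [] \<and> u \<in> C2 \<and> (\<exists>i < length u. v = take (Suc i) u @ drop i u))"

definition root_word :: "letter list \<Rightarrow> bool" where
  "root_word w \<longleftrightarrow> minimal w \<and> \<not> (\<exists>u. minimal u \<and> is_child w u)"

text \<open>Being a child is a property of linear words, so it is not invariant under rotation,
  whereas the counts above are. For instance, \<open>[B, A, B, A_inv, B]\<close> is minimal and has no two
  equal adjacent letters, hence it is a root word; but its rotation \<open>[B, B, A, B, A_inv]\<close> is a
  child of the minimal word \<open>[B, A, B, A_inv]\<close>. This can only happen when the first and last
  letters coincide.\<close>

text \<open>\<open>|(xy)\<^sub>w - (xy')\<^sub>w| = (xx)\<^sub>w = (yy)\<^sub>w\<close>, where \<open>y'\<close> is the inverse of \<open>y\<close>.\<close>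

definition balanced :: "letter \<Rightarrow> letter \<Rightarrow> letter list \<Rightarrow> bool" where
  "balanced x y w \<longleftrightarrow>
     \<bar>int (sym_count [x, y] w) - int (sym_count [x, bar y] w)\<bar> = int (sym_count [x, x] w) \<and>
     sym_count [x, x] w = sym_count [y, y] w"


text \<open>\<open>F2\<close> is a group, so that \<open>auto F2\<close> is its automorphism group.\<close>

lemma reduced_Nil [simp]: "reduced []"
  by (simp add: reduced_def)

lemma reduced_Cons: "reduced (x # w) \<longleftrightarrow> reduced w \<and> (w = [] \<or> hd w \<noteq> bar x)"
  by (cases w) (auto simp: reduced_def)

lemma reduced_cons_red: "reduced w \<Longrightarrow> reduced (cons_red x w)"
  by (cases w) (auto simp: reduced_Cons)

lemma reduced_foldr: "reduced w \<Longrightarrow> reduced (foldr cons_red u w)"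
  by (induction u) (auto simp: reduced_cons_red)

lemma cons_red_cancel:
  assumes "reduced w"
  shows "cons_red x (cons_red (bar x) w) = w"
  using assms by (cases w rule: list.exhaust; cases "tl w") (auto simp: reduced_Cons)

lemma foldr_cons_red:
  assumes "reduced w"
  shows "foldr cons_red (cons_red x v) w = cons_red x (foldr cons_red v w)"
proof (cases v)
  case (Cons y ys)
  then show ?thesis
    using cons_red_cancel[OF reduced_foldr[OF assms], of x ys] by auto
qed simp

lemma foldr_foldr_cons_red:
  "reduced w \<Longrightarrow> foldr cons_red (foldr cons_red u v) w = foldr cons_red u (foldr cons_red v w)"
  by (induction u) (auto simp: foldr_cons_red)

lemma foldr_cons_red_Nil: "reduced u \<Longrightarrow> foldr cons_red u [] = u"
proof (induction u)
  case (Cons x u)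
  then show ?case by (cases u) (auto simp: reduced_Cons)
qed simp

lemma foldr_word_inv: "reduced w \<Longrightarrow> foldr cons_red (word_inv u) (foldr cons_red u w) = w"
proof (induction u)
  case (Cons x u)
  then show ?case
    using cons_red_cancel[OF reduced_foldr[OF Cons.prems], of "bar x" u]
    by (simp add: word_inv_def)
qed (simp add: word_inv_def)

lemma group_F2: "group F2"
proof (rule groupI)
  fix u assume "u \<in> carrier F2"
  then have u: "reduced u" by (simp add: F2_def)
  let ?v = "foldr cons_red (word_inv u) []"
  have "?v \<otimes>\<^bsub>F2\<^esub> u = foldr cons_red (word_inv u) u"
    using foldr_foldr_cons_red[OF u, of "word_inv u" "[]"] by (simp add: F2_def)
  also have "\<dots> = \<one>\<^bsub>F2\<^esub>"
    using foldr_word_inv[of "[]" u] by (simp add: F2_def foldr_cons_red_Nil[OF u])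
  finally show "\<exists>v \<in> carrier F2. v \<otimes>\<^bsub>F2\<^esub> u = \<one>\<^bsub>F2\<^esub>"
    by (intro bexI[of _ ?v]) (simp_all add: F2_def reduced_foldr)
qed (auto simp: F2_def reduced_foldr foldr_foldr_cons_red)

text \<open>As \<open>(xx)\<^sub>w = 0\<close> for words \<open>w\<close> of length 1, a single letter is balanced,
  but it is a child of the empty word and hence not a root word.\<close>

lemma single_letter:
  shows "[x] \<in> C2" and "balanced A B [x]" and "\<not> root_word [x]"
proof -
  show "[x] \<in> C2" by (cases x) (auto simp: C2_def reduced_Cons)
  show "balanced A B [x]"
    by (simp add: balanced_def sym_count_def subword_count_def word_inv_def)
  have "minimal []" by (simp add: minimal_def F2_def)
  then show "\<not> root_word [x]" by (auto simp: root_word_def is_child_def)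
qed

end

theory Submission
  imports Defs
begin

text \<open>
  The heart of the matter is Whitehead's criterion in rank two: a cyclically reduced word \<open>w\<close> is
  minimal iff \<open>|(ab) - (ab\<^sup>-\<^sup>1)|\<close>, called the excess here, is at most \<open>(aa)\<close> and at most \<open>(bb)\<close>
  (\<open>minimal_iff_excess\<close>). Once this is known, root words are a matter of counting. Duplicating
  a letter of a word with at least two letters raises one of \<open>(aa), (bb)\<close> by one and leaves the other
  counts alone. If the excess equals both, such a parent violates the criterion; shorter parents produce only
  single letters and squares of letters, and the latter never satisfy the equations. If the excess is smaller than one of them, some letter of the corresponding kind is
  repeated in the cyclic word, and removing the repetition gives a minimal word. The
  repetition is visible in the linear word unless it joins the last letter to the first, which is
  why either the end letters are required to differ or all rotations are considered.

  One half of the criterion is direct. The automorphism \<open>a \<mapsto> ab\<close> lengthens the cyclic word by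
  \<open>(aa) + (ab) - (ab\<^sup>-\<^sup>1)\<close> (\<open>length_nielsen_cyclic\<close>, with \<open>num_eq\<close>), so minimality forces this to
  be nonnegative. Signed permutations of the letters give the other three inequalities.

  For the converse, think of the bases of the free group, up to conjugation and inversion, as the
  edges of the Farey triangulation. The cyclic length of \<open>w\<close> in a basis is the sum of two
  numbers attached to the end points of the edge, and the resulting function on the vertices is
  convex across every edge. If it does not decrease across the initial edge in either
  direction, it does not decrease along any path that moves away from this edge
  (\<open>outward_nielsen_cyclic\<close>, \<open>positive_length\<close>). Every product of Nielsen automorphisms is such a
  path up to signed permutations and conjugation, because steps that backtrack can be
  removed (\<open>orbit_normal_form\<close>). Finally, every automorphism is a product of Nielsen automorphisms
  (\<open>orbit_invertible\<close>), which is proved by shortening a basis as long as possible.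
  A cyclically reduced word is no longer than any of its conjugates (\<open>conjugate_C2_length\<close>), so the bound on
  cyclic lengths also bounds the lengths of images.
\<close>

section \<open>Reduction of words, substitutions, conjugacy\<close>

definition red :: "letter list \<Rightarrow> letter list" where
  "red w = foldr cons_red w []"

abbreviation subst :: "(letter \<Rightarrow> letter list) \<Rightarrow> letter list \<Rightarrow> letter list" where
  "subst f w \<equiv> concat (map f w)"

text \<open>The substitutions that respect inversion are those that induce endomorphisms of the free group.
  Working with arbitrary words modulo \<open>red\<close> lets compositions of endomorphisms be computed
  letter by letter, without reducing at every stage.\<close>

definition inv_compat :: "(letter \<Rightarrow> letter list) \<Rightarrow> bool" where
  "inv_compat f \<longleftrightarrow> (\<forall>x. f (bar x) = word_inv (f x))"

definition conjugate :: "letter list \<Rightarrow> letter list \<Rightarrow> bool" where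
  "conjugate u v \<longleftrightarrow> (\<exists>g. red v = red (g @ u @ word_inv g))"

lemma bar_neq [simp]: "bar x \<noteq> x" "x \<noteq> bar x"
  by (cases x; simp)+

lemma bar_eq_iff [simp]: "bar x = bar y \<longleftrightarrow> x = y"
  by (metis bar_bar)

lemma word_inv_simps [simp]:
  "word_inv [] = []" "word_inv (x # w) = word_inv w @ [bar x]"
  "word_inv (u @ v) = word_inv v @ word_inv u" "word_inv (word_inv w) = w"
  "length (word_inv w) = length w" "(word_inv w = []) = (w = [])"
  by (auto simp: word_inv_def rev_map comp_def)

lemma reduced_red [simp]: "reduced (red w)"
  by (simp add: red_def reduced_foldr)

lemma red_reduced: "reduced w \<Longrightarrow> red w = w"
  by (simp add: red_def foldr_cons_red_Nil)

lemma red_Nil [simp]: "red [] = []"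
  by (simp add: red_def)

lemma red_single [simp]: "red [x] = [x]"
  by (simp add: red_def)

lemma red_append_foldr: "red (u @ v) = foldr cons_red u (red v)"
  by (simp add: red_def)

lemma red_append_red_left [simp]: "red (red u @ v) = red (u @ v)"
  unfolding red_append_foldr using foldr_foldr_cons_red[of "red v" u "[]"] by (simp add: red_def reduced_foldr)

lemma red_append_red_right [simp]: "red (u @ red v) = red (u @ v)"
  by (simp add: red_append_foldr red_reduced)

lemma red_red [simp]: "red (red u) = red u"
  by (simp add: red_reduced)

lemma red_cong: "red u = red u' \<Longrightarrow> red v = red v' \<Longrightarrow> red (u @ v) = red (u' @ v')"
  by (metis red_append_red_left red_append_red_right)

lemma red_word_inv_cancel [simp]:
  "red (u @ word_inv u @ v) = red v" "red (word_inv u @ u @ v) = red v"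
proof -
  show *: "red (word_inv u @ u @ v) = red v" for u
    using foldr_word_inv[of "red v" u] by (simp add: red_append_foldr[of _ v]
      red_append_foldr[of _ "_ @ v"])
  show "red (u @ word_inv u @ v) = red v"
    using *[of "word_inv u"] by simp
qed

lemma red_word_inv_cancel_Nil [simp]: "red (u @ word_inv u) = []" "red (word_inv u @ u) = []"
  using red_word_inv_cancel[of u "[]"] by simp_all

lemma reduced_append:
  "reduced (u @ v) \<longleftrightarrow> reduced u \<and> reduced v \<and> (u \<noteq> [] \<longrightarrow> v \<noteq> [] \<longrightarrow> hd v \<noteq> bar (last u))"
  by (auto simp: reduced_def successively_append_iff)

lemma reduced_infix: "reduced (u @ v @ w) \<Longrightarrow> reduced v"
  by (simp add: reduced_append)

lemma reduced_word_inv [simp]: "reduced (word_inv w) \<longleftrightarrow> reduced w"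
proof -
  have *: "reduced w \<Longrightarrow> reduced (word_inv w)" for w
  proof (induction w)
    case (Cons x w)
    show ?case
    proof (cases w)
      case (Cons y ys)
      then show ?thesis using Cons.IH Cons.prems
        by (auto simp: reduced_Cons reduced_append)
    qed (auto simp: reduced_Cons)
  qed simp
  show ?thesis using *[of w] *[of "word_inv w"] by auto
qed

lemma red_word_inv: "red (word_inv w) = word_inv (red w)"
proof -
  have "red (word_inv w) = red (word_inv w @ w @ word_inv (red w))"
    using red_append_red_left[of w "word_inv (red w)"]
    by (metis append.right_neutral red_append_red_right red_word_inv_cancel_Nil(1))
  then show ?thesis by (simp add: red_reduced)
qed

lemma subst_word_inv: "inv_compat f \<Longrightarrow> subst f (word_inv w) = word_inv (subst f w)"
  by (induction w) (auto simp: inv_compat_def)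

lemma red_subst_red:
  assumes "inv_compat f"
  shows "red (subst f (red w)) = red (subst f w)"
proof (induction w)
  case (Cons x w)
  have "red (subst f (red (x # w))) = red (f x @ subst f (red w))"
  proof (cases "red w")
    case Nil
    then show ?thesis by (simp add: red_def)
  next
    case (Cons y ys)
    have r: "red (x # w) = cons_red x (red w)" by (simp add: red_def)
    show ?thesis
      using assms unfolding r Cons by (auto simp: inv_compat_def)
  qed
  also have "\<dots> = red (f x @ red (subst f (red w)))" by simp
  finally show ?case by (simp add: Cons.IH)
qed simp

lemma red_subst_cong: "inv_compat f \<Longrightarrow> red u = red v \<Longrightarrow> red (subst f u) = red (subst f v)"
  by (metis red_subst_red)

lemma subst_subst: "subst f (subst g w) = subst (\<lambda>x. subst f (g x)) w"
  by (induction w) auto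

lemma red_subst_cong_fun: "(\<And>x. red (f x) = red (g x)) \<Longrightarrow> red (subst f w) = red (subst g w)"
  by (induction w) (auto intro: red_cong)

lemma letter_UNIV: "(UNIV :: letter set) = {A, A_inv, B, B_inv}"
  using letter.exhaust by auto

lemma finite_letter [simp]: "finite (UNIV :: letter set)"
  by (simp add: letter_UNIV)

lemma all_letter: "(\<forall>x. P x) \<longleftrightarrow> P A \<and> P A_inv \<and> P B \<and> P B_inv"
  using letter.exhaust by metis

lemma conjugate_refl [simp]: "conjugate u u"
  unfolding conjugate_def by (rule exI[of _ "[]"]) simp

lemma conjugate_red: "red u = red v \<Longrightarrow> conjugate u v"
  unfolding conjugate_def by (rule exI[of _ "[]"]) simp

lemma conjugate_trans [trans]: "conjugate u v \<Longrightarrow> conjugate v w \<Longrightarrow> conjugate u w"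
  unfolding conjugate_def
proof (elim exE)
  fix g h assume "red v = red (g @ u @ word_inv g)" "red w = red (h @ v @ word_inv h)"
  then have "red w = red (h @ (g @ u @ word_inv g) @ word_inv h)"
    by (metis red_cong)
  then show "\<exists>g. red w = red (g @ u @ word_inv g)"
    by (intro exI[of _ "h @ g"]) simp
qed

lemma conjugate_sym: "conjugate u v \<Longrightarrow> conjugate v u"
  unfolding conjugate_def
proof (elim exE)
  fix g assume "red v = red (g @ u @ word_inv g)"
  then have "red (word_inv g @ v @ g) = red (word_inv g @ (g @ u @ word_inv g) @ g)"
    by (metis red_cong)
  also have "\<dots> = red (u @ word_inv g @ g)" by simp
  also have "\<dots> = red u"
    by (metis append.right_neutral red_append_red_right red_word_inv_cancel_Nil(2))
  finally show "\<exists>g. red u = red (g @ v @ word_inv g)"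
    by (intro exI[of _ "word_inv g"]) simp
qed

lemma conjugate_subst:
  assumes "inv_compat f" "conjugate u v" shows "conjugate (subst f u) (subst f v)"
proof -
  obtain g where "red v = red (g @ u @ word_inv g)" using assms by (auto simp: conjugate_def)
  from red_subst_cong[OF assms(1) this] show ?thesis
    unfolding conjugate_def by (intro exI[of _ "subst f g"]) (simp add: subst_word_inv[OF assms(1)])
qed

text \<open>Since both substitutions respect inversion, comparing them on the generators is enough.\<close>

lemma conjugate_subst_fun:
  assumes f: "inv_compat f" and g: "inv_compat g"
    and *: "red (f A) = red (h @ g A @ word_inv h)" "red (f B) = red (h @ g B @ word_inv h)"
  shows "conjugate (subst f u) (subst g u)"
proof -
  let ?k = "\<lambda>x. h @ g x @ word_inv h"
  have inv: "red (f (bar x)) = red (?k (bar x))" if "red (f x) = red (?k x)" for x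
    using that f g red_word_inv[of "f x"] red_word_inv[of "?k x"] by (simp add: inv_compat_def)
  have "\<forall>x. red (f x) = red (?k x)"
    using inv[OF *(1)] inv[OF *(2)] * by (simp add: all_letter)
  then have "red (subst f u) = red (subst ?k u)" by (intro red_subst_cong_fun) simp
  moreover have "red (subst ?k u) = red (h @ subst g u @ word_inv h)"
  proof (induction u)
    case (Cons x u)
    have "red (subst ?k (x # u)) = red (?k x @ red (subst ?k u))"
      unfolding red_append_red_right by simp
    also have "\<dots> = red (?k x @ (h @ subst g u @ word_inv h))"
      unfolding Cons.IH red_append_red_right ..
    also have "\<dots> = red ((h @ g x) @ red (word_inv h @ h @ subst g u @ word_inv h))"
      unfolding red_append_red_right by simp
    finally show ?case unfolding red_word_inv_cancel red_append_red_right by simp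
  qed simp
  ultimately have "conjugate (subst g u) (subst f u)" by (auto simp: conjugate_def)
  then show ?thesis by (rule conjugate_sym)
qed

lemma C2_Nil [simp]: "[] \<in> C2"
  by (simp add: C2_def)

lemma C2_iff_square: "w \<in> C2 \<longleftrightarrow> reduced (w @ w)"
  by (cases "w = []") (auto simp: C2_def reduced_append)

lemma C2_reduced: "w \<in> C2 \<Longrightarrow> reduced w"
  by (simp add: C2_def)

lemma C2_append_swap: "u @ v \<in> C2 \<Longrightarrow> v @ u \<in> C2"
  by (cases "u = []"; cases "v = []") (auto simp: C2_def reduced_append)

lemma C2_rotate: "w \<in> C2 \<Longrightarrow> rotate n w \<in> C2"
  by (metis C2_append_swap append_take_drop_id rotate_drop_take)

text \<open>By induction on \<open>g\<close>: conjugating once more by a letter either changes the padding by one letter, or, when there is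
  no padding, moves one letter around the cycle.\<close>

lemma conjugate_C2_form:
  assumes c: "c \<in> C2"
  shows "\<exists>k n. red (g @ c @ word_inv g) = k @ rotate n c @ word_inv k"
proof (induction g)
  case Nil
  show ?case using c by (intro exI[of _ "[]"] exI[of _ 0]) (simp add: red_reduced C2_reduced)
next
  case (Cons x g)
  then obtain k n where kn: "red (g @ c @ word_inv g) = k @ rotate n c @ word_inv k" by blast
  let ?r = "rotate n c"
  have r: "?r \<in> C2" using c by (rule C2_rotate)
  have red_kn: "reduced (k @ ?r @ word_inv k)" by (metis kn reduced_red)
  have eq: "red ((x # g) @ c @ word_inv (x # g)) = red ([x] @ (k @ ?r @ word_inv k) @ [bar x])"
    by (metis (no_types, lifting) append.assoc append_Cons append_Nil kn red_append_red_left red_append_red_right word_inv_simps(2))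
  show ?case
  proof (cases "?r = []")
    case True
    then have "c = []" by simp
    then show ?thesis using red_word_inv_cancel_Nil(1)[of "x # g"] by (intro exI[of _ "[]"]) simp
  next
    case rne: False
    show ?thesis
    proof (cases k)
      case k: (Cons y k')
      show ?thesis
      proof (cases "y = bar x")
        case True
        have "red ([x] @ (k @ ?r @ word_inv k) @ [bar x]) =
              red (([x] @ word_inv [x]) @ (k' @ ?r @ word_inv k') @ ([x] @ word_inv [x]))"
          using k True by simp
        also have "\<dots> = red (k' @ ?r @ word_inv k')"
          by (metis append_Nil append_Nil2 red_append_red_left red_append_red_right red_word_inv_cancel_Nil(1))
        also have "\<dots> = k' @ ?r @ word_inv k'"
        proof (rule red_reduced)
          have "k @ ?r @ word_inv k = [y] @ (k' @ ?r @ word_inv k') @ [bar y]" using k by simp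
          then show "reduced (k' @ ?r @ word_inv k')"
            using red_kn reduced_infix by metis
        qed
        finally show ?thesis using eq by auto
      next
        case False
        have "reduced ([x] @ Z @ [bar x])" if "reduced Z" "Z \<noteq> []" "hd Z = y" "last Z = bar y" for Z
          using that False by (auto simp: reduced_Cons reduced_append)
        from this[of "k @ ?r @ word_inv k"]
        have "reduced ((x # k) @ ?r @ word_inv (x # k))"
          using red_kn k by simp
        then show ?thesis unfolding eq
          by (intro exI[of _ "x # k"] exI[of _ n]) (simp add: red_reduced)
      qed
    next
      case Nil
      note k = this
      have rr: "reduced ?r" using r by (rule C2_reduced)
      consider "hd ?r = bar x" | "last ?r = x" | "hd ?r \<noteq> bar x" "last ?r \<noteq> x" by blast
      then show ?thesis
      proof cases
        case 1
        then obtain t where t: "?r = bar x # t" using rne by (cases ?r) auto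
        have "red ([x] @ (k @ ?r @ word_inv k) @ [bar x]) = red ([x] @ word_inv [x] @ t @ [bar x])"
          using k t by simp
        also have "\<dots> = red (rotate1 ?r)" by (simp only: red_word_inv_cancel) (simp add: t)
        also have "\<dots> = rotate (Suc n) c"
          using C2_reduced[OF C2_rotate[OF c, of "Suc n"]] by (simp add: red_reduced)
        finally show ?thesis using eq by (intro exI[of _ "[]"] exI[of _ "Suc n"]) simp
      next
        case 2
        then obtain t where t: "?r = t @ [x]" using rne by (metis append_butlast_last_id)
        have xt: "x # t = rotate (length t) ?r"
          using rotate_append[of t "[x]"] by (simp only: t) simp
        have xt': "x # t = rotate (length t + n) c" by (simp add: xt rotate_rotate)
        have "red ([x] @ (k @ ?r @ word_inv k) @ [bar x]) = red ((x # t) @ ([x] @ word_inv [x]))"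
          using k t by simp
        also have "\<dots> = red (x # t)"
          by (metis append_Nil2 red_append_red_right red_word_inv_cancel_Nil(1))
        also have "\<dots> = x # t"
          using C2_reduced[OF C2_rotate[OF r, of "length t"]] xt by (simp add: red_reduced)
        finally show ?thesis using eq xt' by (intro exI[of _ "[]"] exI[of _ "length t + n"]) simp
      next
        case 3
        have "reduced ([x] @ ?r @ word_inv [x])"
          using rr rne 3 by (auto simp: reduced_Cons reduced_append)
        then show ?thesis unfolding eq using k
          by (intro exI[of _ "[x]"] exI[of _ n]) (simp add: red_reduced)
      qed
    qed
  qed
qed

lemma conjugate_C2_length:
  assumes "c \<in> C2" "conjugate c v" shows "length c \<le> length (red v)"
proof -
  obtain g where "red v = red (g @ c @ word_inv g)" using assms by (auto simp: conjugate_def)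
  with conjugate_C2_form[OF assms(1), of g] show ?thesis by auto
qed

lemma conjugate_C2_rotate:
  assumes "c \<in> C2" "d \<in> C2" "conjugate c d" shows "\<exists>n. d = rotate n c"
proof -
  obtain g where g: "red d = red (g @ c @ word_inv g)" using assms by (auto simp: conjugate_def)
  with conjugate_C2_form[OF assms(1), of g] assms(2)
  obtain k n where d: "d = k @ rotate n c @ word_inv k" by (auto simp: red_reduced C2_reduced)
  show ?thesis
  proof (cases k)
    case (Cons x k')
    then show ?thesis using d assms(2) by (simp add: C2_def)
  qed (use d in auto)
qed

section \<open>Cyclic subword counts\<close>

text \<open>For words of length at least two, \<open>[xy]\<^sub>w\<close> is the multiplicity of the pair \<open>(x, y)\<close>
  among the cyclically adjacent letters. For \<open>w = [x]\<close> the list contains \<open>(x, x)\<close>, whereas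
  \<open>[xx]\<^sub>w = 0\<close>.\<close>

definition cyc_pairs :: "letter list \<Rightarrow> (letter \<times> letter) list" where
  "cyc_pairs w = zip w (rotate1 w)"

abbreviation num_a :: "letter list \<Rightarrow> nat" where
  "num_a w \<equiv> count_list w A + count_list w A_inv"

abbreviation num_b :: "letter list \<Rightarrow> nat" where
  "num_b w \<equiv> count_list w B + count_list w B_inv"

definition signed_perm :: "(letter \<Rightarrow> letter) \<Rightarrow> bool" where
  "signed_perm \<sigma> \<longleftrightarrow> inj \<sigma> \<and> (\<forall>x. \<sigma> (bar x) = bar (\<sigma> x))"

lemma length_num: "length w = num_a w + num_b w"
proof (induction w)
  case (Cons x w) then show ?case by (cases x) auto
qed simp

lemma count_list_rotate1 [simp]: "count_list (rotate1 w) x = count_list w x"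
  by (cases w) auto

lemma count_list_rotate [simp]: "count_list (rotate n w) x = count_list w x"
  by (induction n) auto

lemma subword_count_pair:
  assumes "length w \<noteq> 1 \<or> x \<noteq> y"
  shows "subword_count [x, y] w = count_list (cyc_pairs w) (x, y)"
proof (cases "length w \<le> 1")
  case True
  then consider "w = []" | z where "w = [z]" by (cases w) auto
  then show ?thesis
    using assms by cases (auto simp: subword_count_def cyc_pairs_def occurrences_def)
next
  case False
  let ?u = "w @ take 1 w"
  have pos: "0 < length w" using False by linarith
  have "take 2 (drop i ?u) = [x, y] \<longleftrightarrow> w ! i = x \<and> rotate1 w ! i = y" if i: "i < length w" for i
  proof -
    have u: "?u = w @ [w ! 0]" using pos by (cases w) auto
    have l: "Suc i < length ?u" using i pos by (simp add: u)
    have d: "drop i ?u = ?u ! i # ?u ! Suc i # drop (Suc (Suc i)) ?u"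
      using l by (metis Cons_nth_drop_Suc Suc_lessD)
    have "?u ! Suc i = w ! (Suc i mod length w)"
    proof (cases "Suc i < length w")
      case False
      then have "Suc i = length w" using i by simp
      then show ?thesis by (simp add: u nth_append)
    qed (simp add: u nth_append)
    then have "?u ! Suc i = rotate1 w ! i" using i by (simp add: nth_rotate1)
    moreover have "?u ! i = w ! i" using i by (simp add: u nth_append)
    ultimately show ?thesis unfolding d by (simp add: numeral_2_eq_2)
  qed
  then have "{i. i + 2 \<le> length ?u \<and> take 2 (drop i ?u) = [x, y]} =
             {i. i < length (cyc_pairs w) \<and> (x, y) = cyc_pairs w ! i}"
    using False by (auto simp: cyc_pairs_def)
  then show ?thesis
    using False by (simp add: subword_count_def occurrences_def count_list_eq_length_filter
      length_filter_conv_card numeral_2_eq_2)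
qed

lemma sym_count_pair:
  assumes "length w \<noteq> 1 \<or> x \<noteq> y"
  shows "sym_count [x, y] w =
    count_list (cyc_pairs w) (x, y) + count_list (cyc_pairs w) (bar y, bar x)"
  using assms subword_count_pair[of w x y] subword_count_pair[of w "bar y" "bar x"]
  by (auto simp: sym_count_def)

lemma sym_count_single [simp]: "length w = 1 \<Longrightarrow> sym_count [x, y] w = 0"
  by (simp add: sym_count_def subword_count_def)

lemma cyc_pairs_rotate1: "cyc_pairs (rotate1 w) = rotate1 (cyc_pairs w)"
proof (cases w)
  case (Cons x v)
  show ?thesis
  proof (cases v)
    case (Cons y u)
    then show ?thesis
      using zip_append[of v "u @ [x]" "[x]" "[y]"] \<open>w = x # v\<close> by (simp add: cyc_pairs_def)
  qed (simp add: \<open>w = x # v\<close> cyc_pairs_def)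
qed (simp add: cyc_pairs_def)

lemma subword_count_rotate [simp]: "subword_count [x, y] (rotate n w) = subword_count [x, y] w"
proof -
  have "count_list (cyc_pairs (rotate n w)) p = count_list (cyc_pairs w) p" for p
  proof (induction n)
    case (Suc n)
    have "count_list (rotate1 ps) p = count_list ps p" for ps :: "(letter \<times> letter) list"
      by (cases ps) auto
    with Suc show ?case by (simp add: cyc_pairs_rotate1)
  qed simp
  then show ?thesis
    using subword_count_pair[of w x y] subword_count_pair[of "rotate n w" x y]
    by (cases "length w = 1") (simp_all add: subword_count_def)
qed

lemma sym_count_rotate [simp]: "sym_count [x, y] (rotate n w) = sym_count [x, y] w"
  by (simp add: sym_count_def)

lemma count_list_map_inj: "inj f \<Longrightarrow> count_list (map f w) (f x) = count_list w x"
  by (induction w) (auto simp: inj_eq)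

lemma subword_count_map:
  assumes "inj \<sigma>" shows "subword_count [\<sigma> x, \<sigma> y] (map \<sigma> w) = subword_count [x, y] w"
proof -
  have "cyc_pairs (map \<sigma> w) = map (map_prod \<sigma> \<sigma>) (cyc_pairs w)"
    by (simp add: cyc_pairs_def rotate1_map zip_map_map map_prod_def)
  moreover have "inj (map_prod \<sigma> \<sigma>)" using assms by (simp add: prod.inj_map)
  ultimately have "count_list (cyc_pairs (map \<sigma> w)) (\<sigma> x, \<sigma> y) = count_list (cyc_pairs w) (x, y)"
    using count_list_map_inj[of "map_prod \<sigma> \<sigma>" "cyc_pairs w" "(x, y)"] by simp
  then show ?thesis
    using subword_count_pair[of w x y] subword_count_pair[of "map \<sigma> w" "\<sigma> x" "\<sigma> y"]
    by (cases "length w = 1") (simp_all add: subword_count_def)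
qed

lemma sym_count_map:
  assumes "signed_perm \<sigma>" shows "sym_count [\<sigma> x, \<sigma> y] (map \<sigma> w) = sym_count [x, y] w"
  using assms subword_count_map[of \<sigma> x y w] subword_count_map[of \<sigma> "bar y" "bar x" w]
  by (simp add: sym_count_def signed_perm_def)

lemma sym_count_word_inv: "sym_count [bar y, bar x] w = sym_count [x, y] w"
  by (simp add: sym_count_def)

lemma C2_cyc_pairs:
  assumes "w \<in> C2" "(x, y) \<in> set (cyc_pairs w)" shows "y \<noteq> bar x"
proof -
  have s: "reduced (w @ w)" using assms(1) by (simp add: C2_iff_square)
  obtain i where i: "i < length w" "x = w ! i" "y = rotate1 w ! i"
    using assms(2) by (auto simp: cyc_pairs_def set_zip)
  have "y = (w @ w) ! Suc i" using i by (auto simp: nth_rotate1 nth_append mod_Suc)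
  moreover have "x = (w @ w) ! i" using i by (simp add: nth_append)
  moreover have "(w @ w) ! Suc i \<noteq> bar ((w @ w) ! i)"
    using s i(1) by (auto simp: reduced_def successively_conv_nth)
  ultimately show ?thesis by simp
qed

text \<open>Every letter of a cyclic word has a successor and a predecessor.\<close>

lemma count_list_cyc_pairs:
  assumes "w \<in> C2"
  shows "count_list w x = (\<Sum>y\<in>UNIV - {bar x}. count_list (cyc_pairs w) (x, y))"
    and "count_list w x = (\<Sum>y\<in>UNIV - {bar x}. count_list (cyc_pairs w) (y, x))"
proof -
  have f: "count_list (map fst ps) x = (\<Sum>y\<in>UNIV. count_list ps (x, y))" for ps :: "(letter \<times> letter) list"
  proof (induction ps)
    case (Cons p ps)
    obtain u v where "p = (u, v)" by fastforce
    then show ?case using Cons by (cases v) (auto simp: letter_UNIV)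
  qed simp
  have g: "count_list (map snd ps) x = (\<Sum>y\<in>UNIV. count_list ps (y, x))" for ps :: "(letter \<times> letter) list"
  proof (induction ps)
    case (Cons p ps)
    obtain u v where "p = (u, v)" by fastforce
    then show ?case using Cons by (cases u) (auto simp: letter_UNIV)
  qed simp
  have z: "count_list (cyc_pairs w) (x, bar x) = 0" "count_list (cyc_pairs w) (bar x, x) = 0"
    using C2_cyc_pairs[OF assms, of x "bar x"] C2_cyc_pairs[OF assms, of "bar x" x]
    by (auto simp: count_list_0_iff)
  have "map fst (cyc_pairs w) = w" "map snd (cyc_pairs w) = rotate1 w"
    by (simp_all add: cyc_pairs_def)
  then have "count_list w x = (\<Sum>y\<in>UNIV. count_list (cyc_pairs w) (x, y))"
    "count_list w x = (\<Sum>y\<in>UNIV. count_list (cyc_pairs w) (y, x))"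
    using f[of "cyc_pairs w"] g[of "cyc_pairs w"] by simp_all
  then show "count_list w x = (\<Sum>y\<in>UNIV - {bar x}. count_list (cyc_pairs w) (x, y))"
    and "count_list w x = (\<Sum>y\<in>UNIV - {bar x}. count_list (cyc_pairs w) (y, x))"
    using z by (simp_all add: sum.remove[of UNIV "bar x"])
qed

lemma sum_letters:
  fixes f :: "letter \<Rightarrow> nat"
  shows "sum f (UNIV - {A_inv}) = f A + f B + f B_inv"
    and "sum f (UNIV - {A}) = f A_inv + f B + f B_inv"
    and "sum f (UNIV - {B_inv}) = f A + f A_inv + f B"
    and "sum f (UNIV - {B}) = f A + f A_inv + f B_inv"
proof -
  have "UNIV - {A_inv} = {A, B, B_inv}" "UNIV - {A} = {A_inv, B, B_inv}"
    "UNIV - {B_inv} = {A, A_inv, B}" "UNIV - {B} = {A, A_inv, B_inv}"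
    by (auto simp: letter_UNIV)
  then show "sum f (UNIV - {A_inv}) = f A + f B + f B_inv"
    and "sum f (UNIV - {A}) = f A_inv + f B + f B_inv"
    and "sum f (UNIV - {B_inv}) = f A + f A_inv + f B"
    and "sum f (UNIV - {B}) = f A + f A_inv + f B_inv"
    by (simp_all add: add.assoc)
qed

lemmas letter_flow = count_list_cyc_pairs(1)[of _ A] count_list_cyc_pairs(1)[of _ A_inv]
  count_list_cyc_pairs(1)[of _ B] count_list_cyc_pairs(1)[of _ B_inv]
  count_list_cyc_pairs(2)[of _ A] count_list_cyc_pairs(2)[of _ A_inv]
  count_list_cyc_pairs(2)[of _ B] count_list_cyc_pairs(2)[of _ B_inv]

lemmas cyclic_flow = letter_flow[unfolded bar.simps sum_letters]

text \<open>A cyclic word enters the letters \<open>a, a\<^sup>-\<^sup>1\<close> as often as it leaves them, in each direction; the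
  counts for \<open>ba\<close> and \<open>ab\<close> therefore agree.\<close>

lemma sym_count_swap:
  assumes "w \<in> C2"
  shows "sym_count [B, A] w = sym_count [A, B] w" "sym_count [B_inv, A] w = sym_count [A, B_inv] w"
  using cyclic_flow[OF assms] by (simp_all add: sym_count_pair)

lemma num_ge:
  assumes "w \<in> C2"
  shows "sym_count [A, B] w + sym_count [A, B_inv] w \<le> num_a w"
    "sym_count [A, B] w + sym_count [A, B_inv] w \<le> num_b w"
  using cyclic_flow[OF assms] by (simp_all add: sym_count_pair)

lemma num_eq:
  assumes "w \<in> C2" "length w \<noteq> 1"
  shows "num_a w = sym_count [A, A] w + sym_count [A, B] w + sym_count [A, B_inv] w"
    "num_b w = sym_count [B, B] w + sym_count [A, B] w + sym_count [A, B_inv] w"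
  using cyclic_flow[OF assms(1)] assms(2) by (simp_all add: sym_count_pair)

section \<open>The elementary Nielsen automorphism on cyclic words\<close>

text \<open>The substitution \<open>a \<mapsto> ab\<close>, \<open>b \<mapsto> b\<close> cuts the image of every letter into a head and a tail.
  Regrouping the image of a cyclic word as a product of factors
  \<open>tail x \<cdot> head y\<close> over the adjacent pairs \<open>xy\<close> puts each cancellation inside one factor: only the
  factors of \<open>ab\<^sup>-\<^sup>1\<close> and \<open>ba\<^sup>-\<^sup>1\<close> cancel, and they cancel completely.
  What remains is cyclically reduced, so its letters can be counted pair by pair.\<close>

fun head_part :: "letter \<Rightarrow> letter list" where
  "head_part A = [A]" | "head_part A_inv = [B_inv]" | "head_part B = []" | "head_part B_inv = [B_inv]"

fun tail_part :: "letter \<Rightarrow> letter list" where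
  "tail_part A = [B]" | "tail_part A_inv = [A_inv]" | "tail_part B = [B]" | "tail_part B_inv = []"

definition nielsen :: "letter \<Rightarrow> letter list" where
  "nielsen x = head_part x @ tail_part x"

definition edge :: "letter \<times> letter \<Rightarrow> letter list" where
  "edge = (\<lambda>(x, y). if (x, y) \<in> {(A, B_inv), (B, A_inv)} then [] else tail_part x @ head_part y)"

definition nielsen_cyclic :: "letter list \<Rightarrow> letter list" where
  "nielsen_cyclic w = concat (map edge (cyc_pairs w))"

lemma nielsen_simps [simp]:
  "nielsen A = [A, B]" "nielsen A_inv = [B_inv, A_inv]" "nielsen B = [B]" "nielsen B_inv = [B_inv]"
  by (simp_all add: nielsen_def)

lemma inv_compat_nielsen: "inv_compat nielsen"
  by (simp add: inv_compat_def all_letter)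

lemma red_edge: "red (edge (x, y)) = red (tail_part x @ head_part y)"
  by (auto simp: edge_def red_def)

text \<open>Regrouping moves only the head of the first letter from the front to the end.\<close>

lemma conjugate_nielsen_cyclic: "conjugate (subst nielsen w) (nielsen_cyclic w)"
proof (cases w)
  case (Cons x v)
  have *: "red (head_part x @ concat (map edge (zip (x # v) (v @ [z])))) =
        red (subst nielsen (x # v) @ head_part z)" for z
  proof (induction v arbitrary: x)
    case Nil
    have "red (head_part x @ edge (x, z)) = red (head_part x @ tail_part x @ head_part z)"
      by (rule red_cong) (simp_all add: red_edge)
    then show ?case by (simp add: nielsen_def)
  next
    case (Cons y v)
    let ?r = "concat (map edge (zip (y # v) (v @ [z])))"
    have "red (head_part x @ edge (x, y) @ ?r) = red (head_part x @ (tail_part x @ head_part y) @ ?r)"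
      by (intro red_cong refl red_edge)
    also have "\<dots> = red (nielsen x @ (head_part y @ ?r))" by (simp add: nielsen_def)
    also have "\<dots> = red (nielsen x @ (subst nielsen (y # v) @ head_part z))"
      by (rule red_cong[OF refl Cons.IH])
    finally show ?case by simp
  qed
  let ?h = "head_part x"
  have "red (subst nielsen w @ ?h) = red (?h @ nielsen_cyclic w)"
    using *[of x] Cons by (simp add: nielsen_cyclic_def cyc_pairs_def)
  then have "red (subst nielsen w @ ?h @ word_inv ?h) = red (?h @ nielsen_cyclic w @ word_inv ?h)"
    using red_cong[of "subst nielsen w @ ?h" "?h @ nielsen_cyclic w" "word_inv ?h" "word_inv ?h"]
    by simp
  moreover have "red (subst nielsen w @ ?h @ word_inv ?h) = red (subst nielsen w)"
    by (metis append_Nil2 red_append_red_right red_word_inv_cancel_Nil(1))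
  ultimately have "conjugate (nielsen_cyclic w) (subst nielsen w)" unfolding conjugate_def by metis
  then show ?thesis by (rule conjugate_sym)
qed (simp add: nielsen_cyclic_def cyc_pairs_def)

text \<open>A factor may be empty, and then the next letter comes from the following factor. The
  induction therefore carries along which letters can begin the product after a given \<open>x\<close>.\<close>

lemma reduced_edges:
  assumes "reduced (x # v)" "E = concat (map edge (zip (x # v) v))"
  shows "reduced E \<and> (E \<noteq> [] \<longrightarrow> (case x of A \<Rightarrow> hd E \<noteq> A_inv | A_inv \<Rightarrow> hd E = A_inv
     | B \<Rightarrow> hd E \<in> {A_inv, B} | B_inv \<Rightarrow> hd E \<in> {A, B_inv}))"
  using assms
proof (induction v arbitrary: x E)
  case (Cons y v)
  define F where "F = concat (map edge (zip (y # v) v))"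
  have E: "E = edge (x, y) @ F" using Cons.prems by (simp add: F_def)
  have xy: "y \<noteq> bar x" "reduced (y # v)" using Cons.prems by (auto simp: reduced_Cons)
  note IH = Cons.IH[OF xy(2) F_def]
  show ?case
    using IH xy(1) unfolding E
    by (cases x; cases y) (auto simp: edge_def reduced_Cons reduced_append split: letter.splits)
qed simp

text \<open>A word is cyclically reduced iff its square is reduced, and the square of the product is the
  linear product of factors along \<open>w\<close> traversed twice.\<close>

lemma nielsen_cyclic_C2:
  assumes "w \<in> C2" shows "nielsen_cyclic w \<in> C2"
proof (cases w)
  case (Cons x v)
  have r: "reduced (x # v @ x # v @ [x])"
  proof -
    have "reduced (w @ w)" "w \<noteq> []" using assms Cons by (simp_all add: C2_iff_square)
    then have "reduced ((w @ w) @ [x])"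
      using assms Cons unfolding reduced_append by (auto simp: C2_def reduced_Cons split: if_splits)
    then show ?thesis using Cons by simp
  qed
  have "zip (x # v @ x # v @ [x]) (v @ x # v @ [x]) = cyc_pairs w @ cyc_pairs w"
  proof -
    have "zip ((x # v) @ (x # v) @ [x]) ((v @ [x]) @ (v @ [x])) = zip (x # v) (v @ [x]) @ zip (x # v) (v @ [x])"
      using zip_append[of "x # v" "v @ [x]" "(x # v) @ [x]" "v @ [x]"]
        zip_append[of "x # v" "v @ [x]" "[x]" "[]"] by simp
    then show ?thesis using Cons by (simp add: cyc_pairs_def)
  qed
  then show ?thesis
    using reduced_edges[OF r refl] by (simp add: C2_iff_square nielsen_cyclic_def)
qed (simp add: nielsen_cyclic_def cyc_pairs_def)

lemma sum_cyc_pairs: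
  "(\<Sum>p\<leftarrow>cyc_pairs w. f (fst p) + g (snd p)) = (\<Sum>x\<leftarrow>w. f x + g x :: nat)"
proof -
  have "(\<Sum>p\<leftarrow>cyc_pairs w. f (fst p) + g (snd p)) =
     sum_list (map f (map fst (cyc_pairs w))) + sum_list (map g (map snd (cyc_pairs w)))"
    by (simp add: sum_list_addf comp_def)
  also have "\<dots> = sum_list (map f w) + sum_list (map g (rotate1 w))"
    by (simp add: cyc_pairs_def)
  also have "sum_list (map g (rotate1 w)) = sum_list (map g w)"
    by (cases w) auto
  finally show ?thesis by (simp add: sum_list_addf)
qed

lemma num_a_nielsen_cyclic: "num_a (nielsen_cyclic w) = num_a w"
proof -
  have "num_a (concat (map edge ps)) = (\<Sum>p\<leftarrow>ps. num_a (tail_part (fst p)) + num_a (head_part (snd p)))" for ps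
  proof (induction ps)
    case (Cons p ps)
    have "num_a (edge p) = num_a (tail_part (fst p)) + num_a (head_part (snd p))"
      by (auto simp: edge_def split: prod.splits)
    with Cons show ?case by simp
  qed simp
  then have "num_a (nielsen_cyclic w) = (\<Sum>x\<leftarrow>w. num_a (tail_part x) + num_a (head_part x))"
    by (simp add: nielsen_cyclic_def sum_cyc_pairs[of "\<lambda>x. num_a (tail_part x)" "\<lambda>x. num_a (head_part x)"])
  also have "\<dots> = num_a w"
  proof (induction w)
    case (Cons x w) then show ?case by (cases x) auto
  qed simp
  finally show ?thesis .
qed

text \<open>Every letter contributes exactly one letter \<open>b\<^sup>\<plusminus>\<^sup>1\<close> through its head or tail, and every cancelling
  pair destroys two of them.\<close>

lemma num_b_nielsen_cyclic:
  "num_b (nielsen_cyclic w) + 2 * sym_count [A, B_inv] w = num_a w + num_b w"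
proof -
  have "num_b (concat (map edge ps)) + 2 * (count_list ps (A, B_inv) + count_list ps (B, A_inv)) =
      (\<Sum>p\<leftarrow>ps. num_b (tail_part (fst p)) + num_b (head_part (snd p)))" for ps
  proof (induction ps)
    case (Cons p ps)
    have "num_b (edge p) + (if p = (A, B_inv) \<or> p = (B, A_inv) then 2 else 0) =
       num_b (tail_part (fst p)) + num_b (head_part (snd p))"
      by (auto simp: edge_def split: prod.splits)
    with Cons show ?case by (auto split: if_splits)
  qed simp
  then have "num_b (nielsen_cyclic w) + 2 * sym_count [A, B_inv] w =
      (\<Sum>x\<leftarrow>w. num_b (tail_part x) + num_b (head_part x))"
    using sum_cyc_pairs[of "\<lambda>x. num_b (tail_part x)" "\<lambda>x. num_b (head_part x)"]
    by (simp add: nielsen_cyclic_def sym_count_pair)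
  also have "\<dots> = num_a w + num_b w"
  proof (induction w)
    case (Cons x w) then show ?case by (cases x) auto
  qed simp
  finally show ?thesis .
qed

lemma length_nielsen_cyclic:
  "length (nielsen_cyclic w) + 2 * sym_count [A, B_inv] w = length w + num_a w"
  using num_a_nielsen_cyclic[of w] num_b_nielsen_cyclic[of w] length_num[of w]
    length_num[of "nielsen_cyclic w"] by linarith

section \<open>Signed permutations\<close>

fun signed :: "letter \<Rightarrow> letter \<Rightarrow> letter \<Rightarrow> letter" where
  "signed u v A = u" | "signed u v A_inv = bar u" | "signed u v B = v" | "signed u v B_inv = bar v"

abbreviation flip_b :: "letter \<Rightarrow> letter" where "flip_b \<equiv> signed A B_inv"
abbreviation swap :: "letter \<Rightarrow> letter" where "swap \<equiv> signed B A"

lemma signed_bar: "signed u v (bar x) = bar (signed u v x)"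
  by (cases x) auto

lemma signed_perm_signed: "v \<notin> {u, bar u} \<Longrightarrow> signed_perm (signed u v)"
  unfolding signed_perm_def
proof (intro conjI allI signed_bar)
  assume "v \<notin> {u, bar u}"
  then have "bar u \<noteq> v" "bar v \<noteq> u" "v \<noteq> bar u" "u \<noteq> bar v" "u \<noteq> v" "v \<noteq> u" by auto
  then have "signed u v x = signed u v y \<Longrightarrow> x = y" for x y
    by (cases x; cases y) simp_all
  then show "inj (signed u v)" by (rule injI)
qed

lemma signed_perm_eq:
  assumes "signed_perm \<sigma>" shows "\<sigma> = signed (\<sigma> A) (\<sigma> B)" "\<sigma> B \<notin> {\<sigma> A, bar (\<sigma> A)}"
proof -
  have b: "\<sigma> (bar x) = bar (\<sigma> x)" for x using assms by (simp add: signed_perm_def)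
  show "\<sigma> = signed (\<sigma> A) (\<sigma> B)"
  proof
    fix x show "\<sigma> x = signed (\<sigma> A) (\<sigma> B) x" using b[of A] b[of B] by (cases x) auto
  qed
  have "inj \<sigma>" using assms by (simp add: signed_perm_def)
  then show "\<sigma> B \<notin> {\<sigma> A, bar (\<sigma> A)}" using b[of A] by (simp add: inj_eq flip: b)
qed

lemma signed_perm_cases:
  assumes "signed_perm \<sigma>"
  shows "\<sigma> \<in> {signed A B, signed A_inv B, signed A B_inv, signed A_inv B_inv,
    signed B A, signed B_inv A, signed B A_inv, signed B_inv A_inv}"
  using signed_perm_eq[OF assms] by (cases "\<sigma> A"; cases "\<sigma> B") auto

lemma signed_perm_comp: "signed_perm \<sigma> \<Longrightarrow> signed_perm \<tau> \<Longrightarrow> signed_perm (\<sigma> \<circ> \<tau>)"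
  by (auto simp: signed_perm_def inj_compose)

lemma map_subst: "map \<sigma> w = subst (\<lambda>x. [\<sigma> x]) w"
  by (induction w) auto

lemma inv_compat_map: "signed_perm \<sigma> \<Longrightarrow> inv_compat (\<lambda>x. [\<sigma> x])"
  by (simp add: inv_compat_def signed_perm_def)

lemma word_inv_map: "signed_perm \<sigma> \<Longrightarrow> word_inv (map \<sigma> w) = map \<sigma> (word_inv w)"
  by (induction w) (auto simp: signed_perm_def)

lemma reduced_map: "signed_perm \<sigma> \<Longrightarrow> reduced (map \<sigma> w) = reduced w"
proof (induction w)
  case (Cons x w)
  have "hd (map \<sigma> w) = bar (\<sigma> x) \<longleftrightarrow> hd w = bar x" if "w \<noteq> []"
    using that Cons.prems unfolding signed_perm_def by (metis hd_map inj_eq)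
  with Cons show ?case by (auto simp: reduced_Cons)
qed simp

lemma C2_map: "signed_perm \<sigma> \<Longrightarrow> map \<sigma> w \<in> C2 \<longleftrightarrow> w \<in> C2"
  using reduced_map[of \<sigma> "w @ w"] by (simp add: C2_iff_square)

lemma conjugate_map: "signed_perm \<sigma> \<Longrightarrow> conjugate u v \<Longrightarrow> conjugate (map \<sigma> u) (map \<sigma> v)"
  unfolding map_subst by (intro conjugate_subst inv_compat_map)

lemma signed_perm_flip_b [simp]: "signed_perm flip_b" and signed_perm_swap [simp]: "signed_perm swap"
  by (simp_all add: signed_perm_signed)

lemma count_flip_b:
  "num_a (map flip_b w) = num_a w" "num_b (map flip_b w) = num_b w"
  "sym_count [A, B_inv] (map flip_b w) = sym_count [A, B] w"
  "sym_count [A, B] (map flip_b w) = sym_count [A, B_inv] w"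
proof -
  show "num_a (map flip_b w) = num_a w"
  proof (induction w)
    case (Cons x w) then show ?case by (cases x) auto
  qed simp
  show "num_b (map flip_b w) = num_b w"
  proof (induction w)
    case (Cons x w) then show ?case by (cases x) auto
  qed simp
qed (use sym_count_map[of flip_b A B w] sym_count_map[of flip_b A B_inv w] in simp_all)

lemma count_swap:
  "num_a (map swap w) = num_b w" "num_b (map swap w) = num_a w"
  "sym_count [A, B_inv] (map swap w) = sym_count [A, B_inv] w"
proof -
  show "num_a (map swap w) = num_b w"
  proof (induction w)
    case (Cons x w) then show ?case by (cases x) auto
  qed simp
  show "num_b (map swap w) = num_a w"
  proof (induction w)
    case (Cons x w) then show ?case by (cases x) auto
  qed simp
qed (use sym_count_map[of swap B A_inv w] sym_count_word_inv[of B_inv A w] in simp)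

section \<open>Convexity of cyclic length\<close>

text \<open>A basis, up to inversion of its elements and conjugation, is an edge of the Farey triangulation.
  A cyclic word assigns a number to every vertex: on the edge of the given basis the two end points
  carry \<open>num_a\<close> and \<open>num_b\<close>, whose sum is the length, and the third vertices of the two adjacent
  triangles carry \<open>num_a + num_b - 2 (ab\<^sup>-\<^sup>1)\<close> and \<open>num_a + num_b - 2 (ab)\<close>. The predicate
  says that the first of these is at least as large as both ends of the edge. The function on the
  vertices is convex, so it does not decrease any more further out on that side of the edge.\<close>

definition outward :: "letter list \<Rightarrow> bool" where
  "outward c \<longleftrightarrow> c \<in> C2 \<and> 2 * sym_count [A, B_inv] c \<le> num_a c \<and> 2 * sym_count [A, B_inv] c \<le> num_b c"

definition nielsen_inv :: "letter \<Rightarrow> letter list" where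
  "nielsen_inv x = map flip_b (nielsen (flip_b x))"

lemma nielsen_inv_simps [simp]:
  "nielsen_inv A = [A, B_inv]" "nielsen_inv A_inv = [B, A_inv]"
  "nielsen_inv B = [B]" "nielsen_inv B_inv = [B_inv]"
  by (simp_all add: nielsen_inv_def)

lemma inv_compat_nielsen_inv: "inv_compat nielsen_inv"
  by (simp add: inv_compat_def all_letter)

lemma subst_nielsen_inv: "subst nielsen_inv w = map flip_b (subst nielsen (map flip_b w))"
  by (induction w) (auto simp: nielsen_inv_def)

lemma nielsen_inv_cancel:
  "red (subst nielsen_inv (subst nielsen w)) = red w"
  "red (subst nielsen (subst nielsen_inv w)) = red w"
proof -
  have "red (subst nielsen_inv (nielsen x)) = red [x]" "red (subst nielsen (nielsen_inv x)) = red [x]" for x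
    by (cases x; simp add: red_def)+
  then show "red (subst nielsen_inv (subst nielsen w)) = red w"
    "red (subst nielsen (subst nielsen_inv w)) = red w"
    using red_subst_cong_fun[of "\<lambda>x. subst nielsen_inv (nielsen x)" "\<lambda>x. [x]" w]
      red_subst_cong_fun[of "\<lambda>x. subst nielsen (nielsen_inv x)" "\<lambda>x. [x]" w]
    by (simp_all add: subst_subst flip: map_subst[of "\<lambda>x. x"])
qed

lemma map_flip_b_flip_b [simp]: "map flip_b (map flip_b w) = w"
proof (induction w)
  case (Cons x w) then show ?case by (cases x) auto
qed simp

text \<open>Let \<open>d\<close> be the image of \<open>c\<close> under \<open>a \<mapsto> ab\<close>. The inverse step brings the number of
  \<open>b\<close>-letters back to that of \<open>c\<close>; since the inverse step is the same step after a change of sign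
  of \<open>b\<close>, this determines \<open>(ab)\<^sub>d = num_a c - (ab\<^sup>-\<^sup>1)\<^sub>c\<close>. Every \<open>a\<close>-letter of \<open>d\<close> accounts for at
  most one of the counts \<open>(ab)\<^sub>d\<close> and \<open>(ab\<^sup>-\<^sup>1)\<^sub>d\<close>, so \<open>(ab\<^sup>-\<^sup>1)\<^sub>d \<le> (ab\<^sup>-\<^sup>1)\<^sub>c\<close>, while neither
  letter count of \<open>d\<close> drops below \<open>2 (ab\<^sup>-\<^sup>1)\<^sub>c\<close>.\<close>

lemma outward_nielsen_cyclic:
  assumes "outward c"
  shows "outward (nielsen_cyclic c)" and "length c \<le> length (nielsen_cyclic c)"
proof -
  let ?d = "nielsen_cyclic c" and ?m = "sym_count [A, B_inv]" and ?p = "sym_count [A, B]"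
  have c: "c \<in> C2" "2 * ?m c \<le> num_a c" "2 * ?m c \<le> num_b c"
    using assms by (auto simp: outward_def)
  have d: "?d \<in> C2" using c(1) by (rule nielsen_cyclic_C2)
  \<comment> \<open>After the change of sign of \<open>b\<close>, the step \<open>a \<mapsto> ab\<close> leads from \<open>d\<close> back to \<open>c\<close>.\<close>
  let ?e = "nielsen_cyclic (map flip_b ?d)"
  have "conjugate (map flip_b c) (subst nielsen (map flip_b (subst nielsen c)))"
    by (rule conjugate_red) (metis map_flip_b_flip_b map_subst red_subst_cong[OF inv_compat_map[OF signed_perm_flip_b]]
      subst_nielsen_inv nielsen_inv_cancel(1))
  also have "conjugate \<dots> (subst nielsen (map flip_b ?d))"
    by (intro conjugate_subst conjugate_map conjugate_nielsen_cyclic inv_compat_nielsen signed_perm_flip_b)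
  also have "conjugate \<dots> ?e" by (rule conjugate_nielsen_cyclic)
  finally obtain n where "?e = rotate n (map flip_b c)"
    using conjugate_C2_rotate[of "map flip_b c" ?e] c(1) d by (auto simp: C2_map nielsen_cyclic_C2)
  then have "num_b ?e = num_b c" by (simp add: count_flip_b)
  with num_b_nielsen_cyclic[of "map flip_b ?d"]
  have "num_b c + 2 * ?p ?d = num_a ?d + num_b ?d" by (simp add: count_flip_b)
  moreover note num_a_nielsen_cyclic[of c] num_b_nielsen_cyclic[of c] num_ge[OF d]
  ultimately show "outward ?d" unfolding outward_def using c d by linarith
  show "length c \<le> length ?d"
    using length_nielsen_cyclic[of c] c by linarith
qed

lemma outward_swap: "outward c \<Longrightarrow> outward (map swap c)"
  by (simp add: outward_def C2_map count_swap)

section \<open>Normal form of products of Nielsen automorphisms\<close>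

text \<open>The rules apply generators of the automorphism group from the left; inner automorphisms enter as
  conjugacy of words.\<close>

inductive orbit :: "letter list \<Rightarrow> letter list \<Rightarrow> bool" for w where
  start: "orbit w w"
| perm: "orbit w v \<Longrightarrow> signed_perm \<sigma> \<Longrightarrow> orbit w (map \<sigma> v)"
| nielsen: "orbit w v \<Longrightarrow> orbit w (subst nielsen v)"
| conjugate: "orbit w v \<Longrightarrow> conjugate v v' \<Longrightarrow> orbit w v'"

lemma orbit_trans: "orbit v u \<Longrightarrow> orbit w v \<Longrightarrow> orbit w u"
  by (induction rule: orbit.induct) (auto intro: orbit.intros)

lemma orbit_nielsen_inv: "orbit w v \<Longrightarrow> orbit w (subst nielsen_inv v)"
  unfolding subst_nielsen_inv by (intro orbit.perm orbit.nielsen signed_perm_flip_b)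

definition swap_nielsen :: "letter \<Rightarrow> letter list" where
  "swap_nielsen x = map swap (nielsen (swap x))"

lemma swap_nielsen_simps [simp]:
  "swap_nielsen A = [A]" "swap_nielsen A_inv = [A_inv]"
  "swap_nielsen B = [B, A]" "swap_nielsen B_inv = [A_inv, B_inv]"
  by (simp_all add: swap_nielsen_def)

lemma map_swap_swap [simp]: "map swap (map swap w) = w"
proof (induction w)
  case (Cons x w) then show ?case by (cases x) auto
qed simp

lemma subst_swap_nielsen: "subst swap_nielsen w = map swap (subst nielsen (map swap w))"
  by (induction w) (auto simp: swap_nielsen_def)

text \<open>These words are the images of \<open>w\<close> along paths without backtracking: a signed permutation chooses
  the side of the first edge, and each further step \<open>a \<mapsto> ab\<close> or \<open>b \<mapsto> ba\<close> moves on to one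
  of the two far edges of the next triangle.\<close>

inductive positive :: "letter list \<Rightarrow> letter list \<Rightarrow> bool" for w where
  start: "signed_perm \<tau> \<Longrightarrow> positive w (map \<tau> w)"
| nielsen: "positive w u \<Longrightarrow> positive w (subst nielsen u)"
| swap_nielsen: "positive w u \<Longrightarrow> positive w (subst swap_nielsen u)"

lemma positive_swap: "positive w u \<Longrightarrow> positive w (map swap u)"
proof (induction rule: positive.induct)
  case (start \<tau>)
  then show ?case using positive.start[of "swap \<circ> \<tau>" w] by (simp add: signed_perm_comp)
next
  case (nielsen u)
  from positive.swap_nielsen[OF nielsen.IH] show ?case
    by (simp only: subst_swap_nielsen map_swap_swap)
next
  case (swap_nielsen u)
  from positive.nielsen[OF swap_nielsen.IH] show ?case
    by (simp only: subst_swap_nielsen map_swap_swap)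
qed

text \<open>The inverse step undoes a preceding \<open>a \<mapsto> ab\<close>. After \<open>b \<mapsto> ba\<close> it amounts, up to conjugation,
  to \<open>a \<mapsto> ab\<close> followed by \<open>a \<mapsto> b\<^sup>-\<^sup>1\<close>, \<open>b \<mapsto> a\<close>: it turns into the other far edge of the same
  triangle. At the start of the path it is the step \<open>a \<mapsto> ab\<close> between two changes of sign.\<close>

lemma positive_nielsen_inv:
  assumes "positive w u"
  shows "\<exists>\<sigma> u'. signed_perm \<sigma> \<and> positive w u' \<and> conjugate (map \<sigma> u') (subst nielsen_inv u)"
  using assms
proof cases
  case (start \<tau>)
  then have "positive w (subst nielsen (map flip_b u))"
    using positive.nielsen[OF positive.start[of "flip_b \<circ> \<tau>" w]] by (simp add: signed_perm_comp)
  then show ?thesis using subst_nielsen_inv[of u]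
    by (intro exI[of _ flip_b] exI[of _ "subst nielsen (map flip_b u)"]) simp
next
  case (nielsen u')
  have "signed_perm id" by (simp add: signed_perm_def)
  moreover have "conjugate (map id u') (subst nielsen_inv u)"
    by (rule conjugate_red) (simp add: nielsen nielsen_inv_cancel)
  ultimately show ?thesis using nielsen by blast
next
  case (swap_nielsen u')
  let ?\<sigma> = "signed B_inv A"
  have "conjugate (subst (\<lambda>x. subst nielsen_inv (swap_nielsen x)) u') (subst (\<lambda>x. map ?\<sigma> (nielsen x)) u')"
    by (rule conjugate_subst_fun[where h = "[B]"]) (simp_all add: inv_compat_def all_letter red_def)
  then have "conjugate (subst nielsen_inv u) (map ?\<sigma> (subst nielsen u'))"
    unfolding swap_nielsen(1) subst_subst by (simp add: map_concat comp_def)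
  then have "conjugate (map ?\<sigma> (subst nielsen u')) (subst nielsen_inv u)" by (rule conjugate_sym)
  moreover have "signed_perm ?\<sigma>" by (simp add: signed_perm_signed)
  ultimately show ?thesis using positive.nielsen[OF swap_nielsen(2)] by blast
qed

text \<open>Conjugating \<open>a \<mapsto> ab\<close> by a signed permutation gives one of \<open>a \<mapsto> ab\<^sup>\<plusminus>\<^sup>1\<close>, \<open>b \<mapsto> ba\<^sup>\<plusminus>\<^sup>1\<close> up to
  an inner automorphism, which is trivial or conjugation by \<open>b\<^sup>-\<^sup>1\<close>. Signed permutations can thus
  be collected on the left.\<close>

lemma nielsen_signed_perm:
  assumes "signed_perm \<sigma>"
  shows "\<exists>X \<in> {nielsen, nielsen_inv, swap_nielsen, \<lambda>x. map swap (nielsen_inv (swap x))}.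
    \<forall>u. conjugate (map \<sigma> (subst X u)) (subst nielsen (map \<sigma> u))"
proof -
  have *: "\<forall>u. conjugate (map \<sigma> (subst X u)) (subst nielsen (map \<sigma> u))"
    if "inv_compat X" "red (nielsen (\<sigma> A)) = red (h @ map \<sigma> (X A) @ word_inv h)"
      "red (nielsen (\<sigma> B)) = red (h @ map \<sigma> (X B) @ word_inv h)" for X h
  proof
    fix u
    have "inv_compat (\<lambda>x. map \<sigma> (X x))"
      using that(1) word_inv_map[OF assms] by (simp add: inv_compat_def)
    moreover have "inv_compat (\<lambda>x. nielsen (\<sigma> x))"
      using assms inv_compat_nielsen by (simp add: inv_compat_def signed_perm_def)
    ultimately have "conjugate (subst (\<lambda>x. nielsen (\<sigma> x)) u) (subst (\<lambda>x. map \<sigma> (X x)) u)"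
      using that by (intro conjugate_subst_fun[where h = h]) auto
    from conjugate_sym[OF this]
    show "conjugate (map \<sigma> (subst X u)) (subst nielsen (map \<sigma> u))"
      by (simp add: map_concat comp_def)
  qed
  let ?X = "\<lambda>x. map swap (nielsen_inv (swap x))"
  have i: "inv_compat nielsen" "inv_compat nielsen_inv" "inv_compat swap_nielsen" "inv_compat ?X"
    by (simp_all add: inv_compat_def all_letter)
  consider (a) "\<sigma> \<in> {signed A B, signed A_inv B_inv}" | (b) "\<sigma> \<in> {signed A B_inv, signed A_inv B}"
    | (c) "\<sigma> \<in> {signed B A, signed B_inv A_inv}" | (d) "\<sigma> \<in> {signed B_inv A, signed B A_inv}"
    using signed_perm_cases[OF assms] by blast
  then show ?thesis
  proof cases
    case a
    then have "\<forall>u. conjugate (map \<sigma> (subst nielsen u)) (subst nielsen (map \<sigma> u))"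
    proof (elim insertE emptyE)
      assume "\<sigma> = signed A B"
      then show ?thesis by (intro *[OF i(1), of "[]"]) (simp_all add: red_def)
    next
      assume "\<sigma> = signed A_inv B_inv"
      then show ?thesis by (intro *[OF i(1), of "[B_inv]"]) (simp_all add: red_def)
    qed
    then show ?thesis by blast
  next
    case b
    then have "\<forall>u. conjugate (map \<sigma> (subst nielsen_inv u)) (subst nielsen (map \<sigma> u))"
    proof (elim insertE emptyE)
      assume "\<sigma> = signed A B_inv"
      then show ?thesis by (intro *[OF i(2), of "[]"]) (simp_all add: red_def)
    next
      assume "\<sigma> = signed A_inv B"
      then show ?thesis by (intro *[OF i(2), of "[B_inv]"]) (simp_all add: red_def)
    qed
    then show ?thesis by blast
  next
    case c
    then have "\<forall>u. conjugate (map \<sigma> (subst swap_nielsen u)) (subst nielsen (map \<sigma> u))"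
    proof (elim insertE emptyE)
      assume "\<sigma> = signed B A"
      then show ?thesis by (intro *[OF i(3), of "[]"]) (simp_all add: red_def)
    next
      assume "\<sigma> = signed B_inv A_inv"
      then show ?thesis by (intro *[OF i(3), of "[B_inv]"]) (simp_all add: red_def)
    qed
    then show ?thesis by blast
  next
    case d
    then have "\<forall>u. conjugate (map \<sigma> (subst ?X u)) (subst nielsen (map \<sigma> u))"
    proof (elim insertE emptyE)
      assume "\<sigma> = signed B_inv A"
      then show ?thesis by (intro *[OF i(4), of "[]"]) (simp_all add: red_def)
    next
      assume "\<sigma> = signed B A_inv"
      then show ?thesis by (intro *[OF i(4), of "[B_inv]"]) (simp_all add: red_def)
    qed
    then show ?thesis by blast
  qed
qed

lemma orbit_normal_form:
  "orbit w v \<Longrightarrow> \<exists>\<sigma> u. signed_perm \<sigma> \<and> positive w u \<and> conjugate (map \<sigma> u) v"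
proof (induction rule: orbit.induct)
  case start
  have "signed_perm id" by (simp add: signed_perm_def)
  then show ?case using positive.start[of id w] by (intro exI[of _ id] exI[of _ w]) (simp add: id_def)
next
  case (perm v \<rho>)
  then obtain \<sigma> u where *: "signed_perm \<sigma>" "positive w u" "conjugate (map \<sigma> u) v" by blast
  have "conjugate (map (\<rho> \<circ> \<sigma>) u) (map \<rho> v)"
    using conjugate_map[OF perm.hyps(2) *(3)] by simp
  then show ?case using * perm.hyps signed_perm_comp by blast
next
  case (nielsen v)
  then obtain \<sigma> u where *: "signed_perm \<sigma>" "positive w u" "conjugate (map \<sigma> u) v" by blast
  have v: "conjugate (subst nielsen (map \<sigma> u)) (subst nielsen v)"
    by (rule conjugate_subst[OF inv_compat_nielsen *(3)])
  have close: ?case if "signed_perm \<rho>" "positive w t" "conjugate (map \<rho> t) (subst X u)"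
    "conjugate (map \<sigma> (subst X u)) (subst nielsen (map \<sigma> u))" for X \<rho> t
  proof -
    have "conjugate (map (\<sigma> \<circ> \<rho>) t) (map \<sigma> (subst X u))"
      using conjugate_map[OF *(1) that(3)] by simp
    from conjugate_trans[OF conjugate_trans[OF this that(4)] v] show ?thesis
      using that signed_perm_comp[OF *(1)] by blast
  qed
  have id: "signed_perm id" by (simp add: signed_perm_def)
  obtain X where X: "X \<in> {nielsen, nielsen_inv, swap_nielsen, \<lambda>x. map swap (nielsen_inv (swap x))}"
    "conjugate (map \<sigma> (subst X u)) (subst nielsen (map \<sigma> u))"
    using nielsen_signed_perm[OF *(1)] by blast
  from X(1) consider "X = nielsen" | "X = swap_nielsen" | "X = nielsen_inv"
    | "X = (\<lambda>x. map swap (nielsen_inv (swap x)))" by blast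
  then show ?case
  proof cases
    case 1
    then show ?thesis using close[OF id _ _ X(2)] positive.nielsen[OF *(2)] by simp
  next
    case 2
    then show ?thesis using close[OF id _ _ X(2)] positive.swap_nielsen[OF *(2)] by simp
  next
    case 3
    then show ?thesis using close[OF _ _ _ X(2)] positive_nielsen_inv[OF *(2)] by blast
  next
    case 4
    obtain \<rho> t where t: "signed_perm \<rho>" "positive w t"
      "conjugate (map \<rho> t) (subst nielsen_inv (map swap u))"
      using positive_nielsen_inv[OF positive_swap[OF *(2)]] by blast
    have "subst X u = map swap (subst nielsen_inv (map swap u))"
      by (simp add: 4 map_concat comp_def)
    then have "conjugate (map (swap \<circ> \<rho>) t) (subst X u)"
      using conjugate_map[OF signed_perm_swap t(3)] by simp
    then show ?thesis using close[OF _ t(2) _ X(2)] signed_perm_comp[OF signed_perm_swap t(1)] by blast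
  qed
next
  case (conjugate v v')
  then show ?case using conjugate_trans by blast
qed

definition locally_minimal :: "letter list \<Rightarrow> bool" where
  "locally_minimal w \<longleftrightarrow> outward w \<and> outward (map flip_b w)"

lemma locally_minimal_flip_b: "locally_minimal w \<Longrightarrow> locally_minimal (map flip_b w)"
  by (simp add: locally_minimal_def del: map_map)

lemma locally_minimal_swap:
  assumes "locally_minimal w" shows "locally_minimal (map swap w)"
proof -
  have "w \<in> C2" using assms by (simp add: locally_minimal_def outward_def)
  then have "sym_count [A, B] (map swap w) = sym_count [A, B] w"
    using sym_count_map[of swap B A w] sym_count_swap(1) by simp
  with assms have "outward (map flip_b (map swap w))"
    unfolding locally_minimal_def outward_def count_flip_b count_swap
    by (simp only: C2_map signed_perm_swap signed_perm_flip_b simp_thms)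
  then show ?thesis using assms outward_swap unfolding locally_minimal_def by blast
qed

text \<open>All signed permutations are generated by the exchange of \<open>a, b\<close> and the change of sign of \<open>b\<close>.\<close>

lemma locally_minimal_map:
  assumes w: "locally_minimal w" and \<tau>: "signed_perm \<tau>"
  shows "locally_minimal (map \<tau> w)"
proof -
  have eq: "signed A B = id" "signed A_inv B = swap \<circ> flip_b \<circ> swap"
    "signed A_inv B_inv = flip_b \<circ> swap \<circ> flip_b \<circ> swap"
    "signed B_inv A = flip_b \<circ> swap" "signed B A_inv = swap \<circ> flip_b"
    "signed B_inv A_inv = flip_b \<circ> swap \<circ> flip_b"
    by (rule ext, case_tac x, simp_all)+
  note fs = locally_minimal_flip_b locally_minimal_swap
  from signed_perm_cases[OF \<tau>] show ?thesis
    unfolding eq using w fs fs[OF fs(1)] by (elim insertE emptyE)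
      (simp_all only: list.map_id map_map[symmetric] fs)
qed

lemma positive_length:
  assumes "positive w u" "locally_minimal w"
  shows "\<exists>c. outward c \<and> conjugate c u \<and> length w \<le> length c"
  using assms(1)
proof (induction rule: positive.induct)
  case (start \<tau>)
  show ?case using locally_minimal_map[OF assms(2) start]
    by (intro exI[of _ "map \<tau> w"]) (simp add: locally_minimal_def)
next
  case (nielsen u)
  then obtain c where c: "outward c" "conjugate c u" "length w \<le> length c" by blast
  have "conjugate (nielsen_cyclic c) (subst nielsen c)"
    by (rule conjugate_sym[OF conjugate_nielsen_cyclic])
  then have "conjugate (nielsen_cyclic c) (subst nielsen u)"
    using conjugate_subst[OF inv_compat_nielsen c(2)] by (rule conjugate_trans)
  then show ?case using outward_nielsen_cyclic[OF c(1)] c(3) by (meson order_trans)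
next
  case (swap_nielsen u)
  then obtain c where c: "outward c" "conjugate c u" "length w \<le> length c" by blast
  let ?c = "map swap c" let ?d = "nielsen_cyclic ?c"
  have "conjugate ?d (subst nielsen ?c)"
    by (rule conjugate_sym[OF conjugate_nielsen_cyclic])
  also have "conjugate (subst nielsen ?c) (subst nielsen (map swap u))"
    by (intro conjugate_subst inv_compat_nielsen conjugate_map signed_perm_swap c)
  finally have "conjugate (map swap ?d) (subst swap_nielsen u)"
    unfolding subst_swap_nielsen by (rule conjugate_map[OF signed_perm_swap])
  moreover have "outward (map swap ?d)" "length w \<le> length (map swap ?d)"
    using outward_nielsen_cyclic[OF outward_swap[OF c(1)]] c(3) by (auto intro: outward_swap)
  ultimately show ?case by blast
qed

lemma orbit_length:
  assumes "orbit w v" "locally_minimal w" shows "length w \<le> length (red v)"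
proof -
  obtain \<sigma> u where \<sigma>: "signed_perm \<sigma>" and u: "positive w u" "conjugate (map \<sigma> u) v"
    using orbit_normal_form[OF assms(1)] by blast
  obtain c where c: "outward c" "conjugate c u" "length w \<le> length c"
    using positive_length[OF u(1) assms(2)] by blast
  have "conjugate (map \<sigma> c) v" using conjugate_map[OF \<sigma> c(2)] u(2) by (rule conjugate_trans)
  moreover have "map \<sigma> c \<in> C2" using c(1) \<sigma> by (simp add: outward_def C2_map)
  ultimately have "length (map \<sigma> c) \<le> length (red v)" by (intro conjugate_C2_length)
  then show ?thesis using c(3) by simp
qed

section \<open>Nielsen reduction of bases\<close>

lemma length_red: "length (red w) \<le> length w"
proof (induction w)
  case (Cons x w)
  have "length (cons_red x v) \<le> Suc (length v)" for v by (cases v) auto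
  from this[of "red w"] show ?case using Cons by (simp add: red_def)
qed simp

text \<open>For reduced \<open>u, v\<close>, reduction of the product removes equally many letters at the end of \<open>u\<close> and at the beginning of \<open>v\<close>.\<close>

definition cancelled :: "letter list \<Rightarrow> letter list \<Rightarrow> nat" where
  "cancelled u v = (length u + length v - length (red (u @ v))) div 2"

lemma cancel_decomp:
  assumes "reduced u" "reduced v"
  obtains p k q where "u = p @ k" "v = word_inv k @ q" "reduced (p @ q)"
    "length k = cancelled u v" "length (red (u @ v)) = length p + length q"
proof -
  have "\<exists>p k q. u = p @ k \<and> v = word_inv k @ q \<and> reduced (p @ q)"
    using assms
  proof (induction u arbitrary: v rule: rev_induct)
    case Nil
    then show ?case by (intro exI[of _ "[]"] exI[of _ v]) simp
  next
    case (snoc x u)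
    show ?case
    proof (cases "v \<noteq> [] \<and> hd v = bar x")
      case True
      then obtain v' where v: "v = bar x # v'" by (cases v) auto
      have "reduced u" "reduced v'" using snoc.prems v by (simp_all add: reduced_append reduced_Cons)
      then obtain p k q where "u = p @ k" "v' = word_inv k @ q" "reduced (p @ q)"
        using snoc.IH by blast
      then show ?thesis using v by (intro exI[of _ p] exI[of _ "k @ [x]"] exI[of _ q]) simp
    next
      case False
      then have "reduced ((u @ [x]) @ v)" using snoc.prems unfolding reduced_append[of "u @ [x]"] by auto
      then show ?thesis by (intro exI[of _ "u @ [x]"] exI[of _ "[]"] exI[of _ v]) simp
    qed
  qed
  then obtain p k q where *: "u = p @ k" "v = word_inv k @ q" "reduced (p @ q)" by blast
  have "red (u @ v) = red (p @ (k @ word_inv k @ q))" using * by simp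
  also have "\<dots> = red (p @ q)" by (metis red_append_red_right red_word_inv_cancel(1))
  also have "\<dots> = p @ q" using * by (simp add: red_reduced)
  finally have l: "length (red (u @ v)) = length p + length q" by simp
  then have "length k = cancelled u v" using * by (simp add: cancelled_def)
  with * l show ?thesis using that by blast
qed

lemma cancelled_word_inv: "cancelled (word_inv v) (word_inv u) = cancelled u v"
  using red_word_inv[of "u @ v"] by (simp add: cancelled_def)

text \<open>If half of \<open>u\<close> cancelled in the square of \<open>u\<close>, letters in mirror positions would be inverse to each
  other. In the middle of \<open>u\<close> this makes a letter its own inverse or two adjacent letters cancel.\<close>

lemma cancelled_self:
  assumes "reduced u" "u \<noteq> []" shows "2 * cancelled u u < length u"
proof (rule ccontr)
  assume "\<not> ?thesis"
  moreover obtain p k q where d: "u = p @ k" "u = word_inv k @ q" "length k = cancelled u u"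
    using cancel_decomp[OF assms(1,1)] by metis
  ultimately have l: "length u \<le> 2 * length k" by simp
  have mirror: "u ! i = bar (u ! (length u - 1 - i))" if "i < length k" for i
  proof -
    have "u ! i = word_inv k ! i" using d(2) that by (simp add: nth_append)
    also have "\<dots> = bar (k ! (length k - 1 - i))"
      using that by (simp add: word_inv_def rev_nth)
    also have "k ! (length k - 1 - i) = u ! (length u - 1 - i)"
    proof -
      have "length u - 1 - i = length p + (length k - 1 - i)" using d(1) that by simp
      then show ?thesis using d(1) by simp
    qed
    finally show ?thesis .
  qed
  have "0 < length u" using assms by simp
  show False
  proof (cases "even (length u)")
    case True
    then obtain n where n: "length u = 2 * n" by blast
    obtain m where m: "n = Suc m" using n \<open>0 < length u\<close> by (cases n) auto
    have "u ! m = bar (u ! Suc m)" using mirror[of m] l n m by simp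
    moreover have "u ! Suc m \<noteq> bar (u ! m)"
      using assms(1) n m by (simp add: reduced_def successively_conv_nth)
    ultimately show False by simp
  next
    case False
    then obtain n where "length u = 2 * n + 1" by (rule oddE)
    then have "u ! n = bar (u ! n)" using mirror[of n] l by simp
    then show False by simp
  qed
qed

text \<open>In a product over a reduced word, some letter of every factor survives the cancellation from both
  sides.\<close>

definition small_cancellation :: "(letter \<Rightarrow> letter list) \<Rightarrow> bool" where
  "small_cancellation f \<longleftrightarrow> (\<forall>x y z. y \<noteq> bar x \<longrightarrow> z \<noteq> bar y \<longrightarrow>
     cancelled (f x) (f y) + cancelled (f y) (f z) < length (f y))"

text \<open>The first factor keeps everything but what cancels against the second one. Knowing this prefix of
  the shorter product shows that the cancellation with one more factor in front stays inside the
  first factor of the shorter product, and the length grows by at least one.\<close>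

lemma small_cancellation_length:
  assumes f: "small_cancellation f" "\<And>x. reduced (f x)"
    and "reduced (x # v)"
  shows "\<exists>t. red (subst f (x # v)) =
      take (length (f x) - (if v = [] then 0 else cancelled (f x) (f (hd v)))) (f x) @ t \<and>
      length (f x) - (if v = [] then 0 else cancelled (f x) (f (hd v))) + length v
        \<le> length (red (subst f (x # v)))"
  using assms(3)
proof (induction v arbitrary: x)
  case Nil
  then show ?case by (simp add: red_reduced f)
next
  case (Cons y v)
  let ?c = "cancelled (f x) (f y)" and ?d = "if v = [] then 0 else cancelled (f y) (f (hd v))"
  let ?r = "red (subst f (y # v))"
  have yv: "reduced (y # v)" "y \<noteq> bar x" using Cons.prems by (auto simp: reduced_Cons)
  obtain t where t: "?r = take (length (f y) - ?d) (f y) @ t"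
    and len: "length (f y) - ?d + length v \<le> length ?r"
    using Cons.IH[OF yv(1)] by blast
  have small: "?c + ?d < length (f y)"
  proof (cases v)
    case Nil
    have "?c + cancelled (f y) (f y) < length (f y)"
      using f(1) yv(2) unfolding small_cancellation_def by simp
    then show ?thesis using Nil by simp
  next
    case (Cons z v')
    then have "z \<noteq> bar y" using yv(1) by (simp add: reduced_Cons)
    then show ?thesis
      using f(1) yv(2) Cons unfolding small_cancellation_def by simp
  qed
  obtain p k q where pkq: "f x = p @ k" "f y = word_inv k @ q" "reduced (p @ q)" "length k = ?c"
    using cancel_decomp[OF f(2) f(2)] by metis
  \<comment> \<open>\<open>?q\<close> is what the image of \<open>y # v\<close> keeps after its prefix \<open>k\<^sup>-\<^sup>1\<close> has cancelled; it
    begins with a letter of \<open>f y\<close>.\<close>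
  let ?q = "take (length q - ?d) q @ t"
  have "take (length (f y) - ?d) (f y) = word_inv k @ take (length q - ?d) q"
    using pkq small by (simp add: Suc_diff_le)
  then have r: "?r = word_inv k @ ?q" using t by simp
  have q: "take (length q - ?d) q \<noteq> []" "q \<noteq> []" using pkq small by auto
  have "red (subst f (x # y # v)) = red (f x @ ?r)" by simp
  also have "\<dots> = red (p @ k @ word_inv k @ ?q)" unfolding r pkq(1) by simp
  also have "\<dots> = red (p @ ?q)" by (metis red_append_red_right red_word_inv_cancel(1))
  also have "\<dots> = p @ ?q"
  proof (rule red_reduced)
    have "reduced (word_inv k @ ?q)" using r reduced_red[of "subst f (y # v)"] by simp
    then have "reduced ?q" using reduced_append[of "word_inv k" ?q] by blast
    moreover have "hd ?q = hd q" using q by (simp add: hd_append)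
    ultimately show "reduced (p @ ?q)" using pkq(3) q by (simp add: reduced_append)
  qed
  finally have eq: "red (subst f (x # y # v)) = p @ ?q" .
  have "length (red (subst f (x # y # v))) + length k = length p + length ?r"
    unfolding eq r by simp
  then have "length p + Suc (length v) \<le> length (red (subst f (x # y # v)))"
    using len small pkq(4) by simp
  moreover have "take (length (f x) - ?c) (f x) = p" "length (f x) - ?c = length p"
    using pkq by simp_all
  ultimately show ?case unfolding eq by simp
qed

lemma small_cancellation_expands:
  assumes f: "small_cancellation f" "\<And>x. reduced (f x)" and "reduced w"
  shows "length w \<le> length (red (subst f w))"
proof (cases w)
  case (Cons x v)
  have "(if v = [] then 0 else cancelled (f x) (f (hd v))) < length (f x)"
  proof -
    have "cancelled (f x) (f x) + cancelled (f x) (f (hd v)) < length (f x)" if "v \<noteq> []"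
      using f(1) assms(3) that Cons unfolding small_cancellation_def by (simp add: reduced_Cons)
    moreover have "cancelled (f x) (f x) + cancelled (f x) (f x) < length (f x)"
      using f(1) unfolding small_cancellation_def by simp
    ultimately show ?thesis by fastforce
  qed
  then show ?thesis using small_cancellation_length[OF f, of x v] assms(3) Cons by auto
qed simp

text \<open>By \<open>invertible_of_auto\<close> and \<open>auto_of_invertible\<close> below, these are the automorphisms.\<close>

definition invertible :: "(letter \<Rightarrow> letter list) \<Rightarrow> bool" where
  "invertible f \<longleftrightarrow> inv_compat f \<and> (\<forall>x. reduced (f x)) \<and>
     (\<forall>w. red (subst f w) = [] \<longrightarrow> red w = []) \<and> (\<forall>x. \<exists>w. red (subst f w) = [x])"

lemma invertible_surj: "invertible f \<Longrightarrow> \<exists>w. red (subst f w) = red v"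
proof (induction v)
  case Nil
  show ?case by (intro exI[of _ "[]"]) simp
next
  case (Cons x v)
  then obtain w where "red (subst f w) = red v" by blast
  moreover obtain u where "red (subst f u) = red [x]"
    using Cons.prems unfolding invertible_def red_single by blast
  ultimately have "red (subst f u @ subst f w) = red ([x] @ v)" by (intro red_cong)
  then show ?case by (intro exI[of _ "u @ w"]) simp
qed

lemma invertible_nonempty: "invertible f \<Longrightarrow> f x \<noteq> []"
proof
  assume "invertible f" "f x = []"
  then have "red [x] = []" unfolding invertible_def by (metis append_Nil2 concat.simps list.map red_Nil)
  then show False by simp
qed

text \<open>The basis \<open>f x, f y\<close>, where \<open>x, y\<close> are the images of \<open>a, b\<close> under \<open>\<sigma>\<close>, is replaced by \<open>f x \<cdot> f y\<close>
  and \<open>f y\<close>, and both are conjugated by \<open>h\<close>. Conjugation is part of the move because some bases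
  become shorter only when it is combined with the multiplication.\<close>

definition nielsen_move :: "letter list \<Rightarrow> (letter \<Rightarrow> letter) \<Rightarrow> (letter \<Rightarrow> letter list) \<Rightarrow> letter \<Rightarrow> letter list"
  where "nielsen_move h \<sigma> f x = red (h @ subst f (map \<sigma> (nielsen x)) @ word_inv h)"

lemma signed_perm_inverse:
  assumes "signed_perm \<sigma>"
  obtains \<rho> where "signed_perm \<rho>" "\<And>w. map \<sigma> (map \<rho> w) = w" "\<And>w. map \<rho> (map \<sigma> w) = w"
proof -
  have i: "inj \<sigma>" using assms by (simp add: signed_perm_def)
  then have s: "surj \<sigma>" by (simp add: finite_UNIV_inj_surj)
  have "signed_perm (inv_into UNIV \<sigma>)"
    using assms i s unfolding signed_perm_def by (metis inv_f_f surj_f_inv_f surj_imp_inj_inv)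
  moreover have "\<sigma> \<circ> inv_into UNIV \<sigma> = id" "inv_into UNIV \<sigma> \<circ> \<sigma> = id" using i s by (simp_all add: surj_iff)
  ultimately show ?thesis using that[of "inv_into UNIV \<sigma>"] by (metis list.map_comp list.map_id)
qed

lemma red_nielsen_move:
  assumes "inv_compat f"
  shows "red (subst (nielsen_move h \<sigma> f) w) =
    red (h @ subst f (map \<sigma> (subst nielsen w)) @ word_inv h)"
proof (induction w)
  case (Cons x w)
  let ?X = "subst f (map \<sigma> (nielsen x))" and ?W = "subst f (map \<sigma> (subst nielsen w))"
  have "red (subst (nielsen_move h \<sigma> f) (x # w)) = red ((h @ ?X @ word_inv h) @ (h @ ?W @ word_inv h))"
    unfolding list.map concat.simps
    by (rule red_cong[OF _ Cons.IH]) (simp only: nielsen_move_def red_red)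
  also have "\<dots> = red ((h @ ?X) @ (word_inv h @ h @ ?W @ word_inv h))"
    by (simp only: append_assoc)
  also have "\<dots> = red ((h @ ?X) @ (?W @ word_inv h))"
    by (metis red_append_red_right red_word_inv_cancel(2))
  finally show ?case by simp
qed simp

lemma red_conjugate_iff: "red (h @ u @ word_inv h) = red v \<longleftrightarrow> red u = red (word_inv h @ v @ h)"
proof
  assume "red (h @ u @ word_inv h) = red v"
  then have "red (word_inv h @ (h @ u @ word_inv h) @ h) = red (word_inv h @ v @ h)"
    by (intro red_cong refl)
  then show "red u = red (word_inv h @ v @ h)"
    by (metis append.assoc append_Nil2 red_append_red_right red_word_inv_cancel(2) red_word_inv_cancel_Nil(2))
next
  assume "red u = red (word_inv h @ v @ h)"
  then have "red (h @ u @ word_inv h) = red (h @ (word_inv h @ v @ h) @ word_inv h)"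
    by (intro red_cong refl)
  then show "red (h @ u @ word_inv h) = red v"
    by (metis append.assoc append_Nil2 red_append_red_right red_word_inv_cancel(1) red_word_inv_cancel_Nil(1))
qed

lemma invertible_nielsen_move:
  assumes f: "invertible f" and \<sigma>: "signed_perm \<sigma>"
  shows "invertible (nielsen_move h \<sigma> f)"
proof -
  have c: "inv_compat f" using f by (simp add: invertible_def)
  obtain \<rho> where \<rho>: "signed_perm \<rho>" "\<And>w. map \<sigma> (map \<rho> w) = w" "\<And>w. map \<rho> (map \<sigma> w) = w"
    using signed_perm_inverse[OF \<sigma>] by blast
  show ?thesis unfolding invertible_def
  proof (intro conjI allI impI)
    have n: "nielsen (bar x) = word_inv (nielsen x)" for x
      using inv_compat_nielsen by (simp add: inv_compat_def)
    show "inv_compat (nielsen_move h \<sigma> f)"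
      unfolding inv_compat_def nielsen_move_def n
      by (simp add: red_word_inv[symmetric] subst_word_inv[OF c] word_inv_map[OF \<sigma>, symmetric] del: map_map)
  next
    fix w assume "red (subst (nielsen_move h \<sigma> f) w) = []"
    then have "red (subst f (map \<sigma> (subst nielsen w))) = []"
      using red_conjugate_iff[of h _ "[]"] by (simp add: red_nielsen_move[OF c])
    then have "red (map \<sigma> (subst nielsen w)) = red []" using f by (simp add: invertible_def)
    then have "red (map \<rho> (map \<sigma> (subst nielsen w))) = red (map \<rho> [])"
      unfolding map_subst[of \<rho>] by (rule red_subst_cong[OF inv_compat_map[OF \<rho>(1)]])
    then have "red (subst nielsen w) = red []" unfolding \<rho>(3) by simp
    then have "red (subst nielsen_inv (subst nielsen w)) = red (subst nielsen_inv [])"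
      by (rule red_subst_cong[OF inv_compat_nielsen_inv])
    then show "red w = []" by (simp add: nielsen_inv_cancel)
  next
    fix x
    obtain u where u: "red (subst f u) = red (word_inv h @ [x] @ h)"
      using invertible_surj[OF f] by blast
    let ?w = "subst nielsen_inv (map \<rho> u)"
    have "red (map \<sigma> (subst nielsen ?w)) = red (map \<sigma> (map \<rho> u))"
      unfolding map_subst[of \<sigma>]
      by (rule red_subst_cong[OF inv_compat_map[OF \<sigma>] nielsen_inv_cancel(2)])
    then have "red (subst f (map \<sigma> (subst nielsen ?w))) = red (word_inv h @ [x] @ h)"
      using red_subst_cong[OF c] u by (metis \<rho>(2))
    then have "red (subst (nielsen_move h \<sigma> f) ?w) = [x]"
      using red_conjugate_iff[of h _ "[x]"] unfolding red_nielsen_move[OF c] by simp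
    then show "\<exists>w. red (subst (nielsen_move h \<sigma> f) w) = [x]" by blast
  qed (simp add: nielsen_move_def)
qed

lemma orbit_nielsen_move:
  assumes c: "inv_compat f" and \<sigma>: "signed_perm \<sigma>"
    and *: "\<And>w. orbit w (subst (nielsen_move h \<sigma> f) w)"
  shows "orbit w (subst f w)"
proof -
  obtain \<rho> where \<rho>: "signed_perm \<rho>" "\<And>w. map \<sigma> (map \<rho> w) = w" "\<And>w. map \<rho> (map \<sigma> w) = w"
    using signed_perm_inverse[OF \<sigma>] by blast
  let ?w = "subst nielsen_inv (map \<rho> w)"
  have o: "orbit w ?w" using \<rho>(1) by (intro orbit_nielsen_inv orbit.perm orbit.start)
  have "red (map \<sigma> (subst nielsen ?w)) = red (map \<sigma> (map \<rho> w))"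
    unfolding map_subst[of \<sigma>]
    by (rule red_subst_cong[OF inv_compat_map[OF \<sigma>] nielsen_inv_cancel(2)])
  then have "red (subst f (map \<sigma> (subst nielsen ?w))) = red (subst f w)"
    using red_subst_cong[OF c] by (metis \<rho>(2))
  then have "red (subst (nielsen_move h \<sigma> f) ?w) = red (h @ subst f w @ word_inv h)"
    unfolding red_nielsen_move[OF c] by (intro red_cong refl)
  then have "conjugate (subst f w) (subst (nielsen_move h \<sigma> f) ?w)"
    unfolding conjugate_def by blast
  then have "orbit ?w (subst f w)" using * conjugate_sym orbit.conjugate by blast
  then show ?thesis using o by (rule orbit_trans)
qed

definition total_length :: "(letter \<Rightarrow> letter list) \<Rightarrow> nat" where
  "total_length f = length (f A) + length (f B)"

lemma total_length_eq:
  assumes "inv_compat f" "y \<notin> {x, bar x}" shows "total_length f = length (f x) + length (f y)"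
proof -
  have "length (f A_inv) = length (f A)" "length (f B_inv) = length (f B)"
    using assms(1) unfolding inv_compat_def by (metis bar.simps word_inv_simps(5))+
  then show ?thesis using assms(2) by (cases x; cases y) (simp_all add: total_length_def)
qed

text \<open>If no move without conjugation shortens the basis, at most half of \<open>f x\<close> and of \<open>f y\<close> cancel in
  \<open>f x \<cdot> f y\<close>. A factor \<open>f y\<close> can then disappear in \<open>f x \<cdot> f y \<cdot> f z\<close> only when exactly one half
  cancels on each side. If \<open>z\<close> is the inverse of \<open>x\<close>, the two halves of \<open>f y\<close> are inverse to
  each other, which is impossible in a nonempty reduced word. If \<open>z = x\<close>, then \<open>f y = k\<^sup>-\<^sup>1 k'\<close> and
  \<open>f x = k'\<^sup>-\<^sup>1 m k\<close>, and the pair \<open>f x \<cdot> f y, f y\<close> conjugated by \<open>k'\<close> is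
  \<open>m, k' k\<^sup>-\<^sup>1\<close>, which is shorter.\<close>

lemma small_cancellation_if_shortest:
  assumes f: "invertible f"
    and short: "\<And>h \<sigma>. signed_perm \<sigma> \<Longrightarrow> total_length f \<le> total_length (nielsen_move h \<sigma> f)"
  shows "small_cancellation f"
  unfolding small_cancellation_def
proof (intro allI impI)
  have c: "inv_compat f" and r: "\<And>x. reduced (f x)" using f by (auto simp: invertible_def)
  have bar: "f (bar x) = word_inv (f x)" for x using c by (simp add: inv_compat_def)
  have mv: "length (f x) + length (f y) \<le> length (red (h @ f x @ f y @ word_inv h)) + length (red (h @ f y @ word_inv h))"
    if "y \<notin> {x, bar x}" for x y h
  proof -
    have "total_length f \<le> total_length (nielsen_move h (signed x y) f)"
      using that by (intro short signed_perm_signed)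
    then show ?thesis using total_length_eq[OF c that]
      by (simp add: total_length_def[of "nielsen_move h (signed x y) f"] nielsen_move_def)
  qed
  have half2: "2 * cancelled (f x) (f y) \<le> length (f y)" if "y \<notin> {x, bar x}" for x y
  proof -
    obtain p k q where "f x = p @ k" "f y = word_inv k @ q" "length k = cancelled (f x) (f y)"
      "length (red (f x @ f y)) = length p + length q"
      using cancel_decomp[OF r r] by metis
    moreover have "length (f x) \<le> length (red (f x @ f y))"
      using mv[OF that, of "[]"] by (simp add: red_reduced r)
    ultimately show ?thesis by simp
  qed
  have half1: "2 * cancelled (f x) (f y) \<le> length (f x)" if "y \<notin> {x, bar x}" for x y
    using half2[of "bar x" "bar y"] that by (auto simp: bar cancelled_word_inv)
  have self: "2 * cancelled (f y) (f y) < length (f y)" for y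
    by (rule cancelled_self[OF r invertible_nonempty[OF f]])
  fix x y z assume xy: "y \<noteq> bar x" and yz: "z \<noteq> bar y"
  show "cancelled (f x) (f y) + cancelled (f y) (f z) < length (f y)"
  proof (cases "x = y \<or> z = y")
    case True
    have "2 * cancelled (f x) (f y) \<le> length (f y)"
      using half2[of y x] self[of y] xy by (cases "x = y") auto
    moreover have "2 * cancelled (f y) (f z) \<le> length (f y)"
      using half1[of z y] self[of y] yz by (cases "z = y") auto
    ultimately show ?thesis using True self[of y] by auto
  next
    case False
    have i: "y \<notin> {x, bar x}" "z \<notin> {y, bar y}" using False xy yz by auto
    show ?thesis
    proof (rule ccontr)
      assume "\<not> ?thesis"
      then have eq: "2 * cancelled (f x) (f y) = length (f y)" "2 * cancelled (f y) (f z) = length (f y)"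
        using half2[OF i(1)] half1[OF i(2)] by auto
      obtain p k q where pkq: "f x = p @ k" "f y = word_inv k @ q" "length k = cancelled (f x) (f y)"
        using cancel_decomp[OF r r] by metis
      obtain p' k' q' where pkq': "f y = p' @ k'" "f z = word_inv k' @ q'" "length k' = cancelled (f y) (f z)"
        using cancel_decomp[OF r r] by metis
      have l: "length k' = length k" using eq pkq(3) pkq'(3) by simp
      have "length p' = length k" using eq(2) pkq'(1,3) l by simp
      then have y: "f y = word_inv k @ k'" using pkq(2) pkq'(1) by (simp add: append_eq_append_conv)
      consider "z = bar x" | "z = x"
        using i by (cases x; cases y; cases z) simp_all
      then show False
      proof cases
        case 1
        then have "word_inv k' @ q' = word_inv k @ word_inv p" using pkq(1) pkq'(2) by (simp add: bar)
        then have "word_inv k' = word_inv k" using l by (simp add: append_eq_append_conv)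
        then have "k' = k" by (metis word_inv_simps(4))
        moreover have "k \<noteq> []" using y invertible_nonempty[OF f, of y] l by auto
        moreover have "reduced (word_inv k @ k')" using r[of y] y by simp
        moreover have "last (word_inv k) = bar (hd k)" using \<open>k \<noteq> []\<close> by (cases k) auto
        ultimately show False unfolding reduced_append by simp
      next
        case 2
        have "length k \<le> length p" using half1[OF i(1)] pkq by simp
        then have "take (length k) p = word_inv k'"
          using pkq(1) pkq'(2) 2 l by (metis append_eq_append_conv_if append_take_drop_id length_take min.absorb2 word_inv_simps(5) take_append append_eq_conv_conj diff_is_0_eq' take_0 append_Nil2)
        then obtain m where x: "f x = word_inv k' @ m @ k"
          using pkq(1) by (metis append.assoc append_take_drop_id)
        have "red (k' @ f x @ f y @ word_inv k') = red ((k' @ word_inv k' @ m) @ (k @ word_inv k @ k' @ word_inv k'))"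
          by (simp add: x y)
        also have "\<dots> = red m"
          by (metis append_Nil2 red_append_red_left red_append_red_right red_word_inv_cancel(1) red_word_inv_cancel_Nil(1))
        finally have "length (red (k' @ f x @ f y @ word_inv k')) \<le> length m" using length_red by simp
        moreover have "red (k' @ f y @ word_inv k') = red (k' @ word_inv k)"
          by (metis y append.assoc append_Nil2 red_append_red_right red_word_inv_cancel_Nil(1))
        then have "length (red (k' @ f y @ word_inv k')) \<le> length (f y)"
          using length_red[of "k' @ word_inv k"] y by simp
        moreover have "length (f x) > length m" using x y l invertible_nonempty[OF f, of y] by auto
        ultimately show False using mv[OF i(1), of k'] by simp
      qed
    qed
  qed
qed

text \<open>Nielsen's theorem in rank two. A shortest basis has small cancellation, so substituting it into a
  reduced word never shortens the word. Since every letter is a value of the substitution, it is the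
  image of a single letter, and the substitution is a signed permutation.\<close>

lemma orbit_invertible:
  assumes "invertible f" shows "orbit w (subst f w)"
  using assms
proof (induction "total_length f" arbitrary: f w rule: less_induct)
  case less
  have c: "inv_compat f" and r: "\<And>x. reduced (f x)" using less.prems by (auto simp: invertible_def)
  show ?case
  proof (cases "\<exists>h \<sigma>. signed_perm \<sigma> \<and> total_length (nielsen_move h \<sigma> f) < total_length f")
    case True
    then obtain h \<sigma> where *: "signed_perm \<sigma>" "total_length (nielsen_move h \<sigma> f) < total_length f" by blast
    show ?thesis
      using orbit_nielsen_move[OF c *(1)] less.hyps[OF *(2) invertible_nielsen_move[OF less.prems *(1)]] by blast
  next
    case False
    have sc: "small_cancellation f"
      using False by (intro small_cancellation_if_shortest less.prems) (meson not_less)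
    have "\<exists>y. f y = [x]" for x
    proof -
      obtain u where u: "red (subst f (red u)) = [x]"
        using less.prems red_subst_red[OF c] unfolding invertible_def by metis
      then have "length (red u) \<le> 1" using small_cancellation_expands[OF sc r, of "red u"] by simp
      then obtain y where "red u = [y]" using u by (cases "red u") auto
      then show ?thesis using u by (auto simp: red_reduced r)
    qed
    then obtain g where g: "\<And>x. f (g x) = [x]" by metis
    have "inj g" using g by (metis injI list.inject)
    then have "surj g" by (simp add: finite_UNIV_inj_surj)
    then have fx: "f x = [inv_into UNIV g x]" for x using g by (metis surj_f_inv_f)
    have "signed_perm (inv_into UNIV g)" unfolding signed_perm_def
    proof (intro conjI allI)
      show "inj (inv_into UNIV g)" using \<open>surj g\<close> by (rule surj_imp_inj_inv)
      fix x show "inv_into UNIV g (bar x) = bar (inv_into UNIV g x)"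
        using c unfolding inv_compat_def fx by simp
    qed
    then have "orbit w (map (inv_into UNIV g) w)" by (intro orbit.perm orbit.start)
    moreover have "subst f w = map (inv_into UNIV g) w" by (induction w) (simp_all add: fx)
    ultimately show ?thesis by simp
  qed
qed

section \<open>Minimal words\<close>

lemma carrier_F2: "w \<in> carrier F2 \<longleftrightarrow> reduced w"
  by (simp add: F2_def)

lemma mult_F2: "reduced v \<Longrightarrow> u \<otimes>\<^bsub>F2\<^esub> v = red (u @ v)"
  by (simp add: F2_def red_append_foldr red_reduced)

lemma auto_of_invertible:
  assumes f: "invertible f"
  shows "(\<lambda>w\<in>carrier F2. red (subst f w)) \<in> auto F2"
proof -
  let ?\<phi> = "\<lambda>w\<in>carrier F2. red (subst f w)"
  have c: "inv_compat f" using f by (simp add: invertible_def)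
  have "?\<phi> \<in> hom F2 F2"
    by (intro homI) (simp_all add: carrier_F2 mult_F2 red_subst_red[OF c])
  moreover have "inj_on ?\<phi> (carrier F2)"
  proof (rule inj_onI)
    fix u v assume *: "u \<in> carrier F2" "v \<in> carrier F2" "?\<phi> u = ?\<phi> v"
    then have "red (word_inv (subst f u) @ subst f v) = red (word_inv (subst f u) @ subst f u)"
      by (intro red_cong) simp_all
    then have "red (subst f (word_inv u @ v)) = []" by (simp add: subst_word_inv[OF c])
    then have "red (word_inv u @ v) = red []" using f by (simp add: invertible_def)
    then have "red (u @ word_inv u @ v) = red (u @ [])" by (intro red_cong refl)
    then show "u = v" using * by (simp add: carrier_F2 red_reduced)
  qed
  moreover have "?\<phi> ` carrier F2 = carrier F2"
  proof (intro equalityI subsetI)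
    fix v assume v: "v \<in> carrier F2"
    obtain u where "red (subst f u) = red v" using invertible_surj[OF f] by blast
    then have "v = ?\<phi> (red u)" using v by (simp add: carrier_F2 red_subst_red[OF c] red_reduced)
    then show "v \<in> ?\<phi> ` carrier F2" by (rule image_eqI) (simp add: carrier_F2)
  qed (auto simp: carrier_F2)
  ultimately show ?thesis by (simp add: auto_def Bij_def bij_betw_def)
qed

lemma invertible_of_auto:
  assumes \<phi>: "\<phi> \<in> auto F2"
  shows "invertible (\<lambda>x. \<phi> [x])" and "reduced w \<Longrightarrow> \<phi> w = red (subst (\<lambda>x. \<phi> [x]) w)"
proof -
  let ?f = "\<lambda>x. \<phi> [x]"
  have hom: "\<phi> \<in> hom F2 F2" and bij: "bij_betw \<phi> (carrier F2) (carrier F2)"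
    using \<phi> by (auto simp: auto_def Bij_def)
  have r: "reduced (\<phi> w)" if "reduced w" for w
    using hom that by (auto simp: hom_def carrier_F2 Pi_iff)
  have m: "\<phi> (red (u @ v)) = red (\<phi> u @ \<phi> v)" if "reduced u" "reduced v" for u v
    using hom_mult[OF hom, of u v] that r by (simp add: carrier_F2 mult_F2)
  have "group_hom F2 F2 \<phi>"
    using group_F2 hom by (simp add: group_hom_def group_hom_axioms_def)
  from group_hom.hom_one[OF this] have one: "\<phi> [] = []" by (simp add: F2_def)
  have r1: "reduced [x]" for x by (simp add: reduced_Cons)
  have c: "inv_compat ?f" unfolding inv_compat_def
  proof
    fix x
    have "red (\<phi> [x] @ \<phi> [bar x]) = red []"
      using m[OF r1 r1, of x "bar x"] one by (simp add: red_def)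
    then have "red (word_inv (\<phi> [x]) @ \<phi> [x] @ \<phi> [bar x]) = red (word_inv (\<phi> [x]) @ [])"
      by (intro red_cong refl)
    then show "\<phi> [bar x] = word_inv (\<phi> [x])" using r[OF r1] by (simp add: red_reduced)
  qed
  have eq: "\<phi> w = red (subst ?f w)" if "reduced w" for w
    using that
  proof (induction w)
    case (Cons x w)
    then have "\<phi> (red ([x] @ w)) = red (\<phi> [x] @ \<phi> w)" by (intro m) (auto simp: reduced_Cons)
    with Cons show ?case by (simp add: red_reduced) (simp add: reduced_Cons)
  qed (simp add: one)
  then show "reduced w \<Longrightarrow> \<phi> w = red (subst ?f w)" .
  show "invertible ?f" unfolding invertible_def
  proof (intro conjI allI impI c r r1)
    fix w assume "red (subst ?f w) = []"
    then have "\<phi> (red w) = \<phi> []" using eq[of "red w"] one by (simp add: red_subst_red[OF c])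
    then show "red w = []" using bij by (auto simp: bij_betw_def carrier_F2 dest: inj_onD)
  next
    fix x
    have "[x] \<in> \<phi> ` carrier F2" using bij r1 by (simp add: bij_betw_def carrier_F2)
    then show "\<exists>w. red (subst ?f w) = [x]" using eq by (auto simp: carrier_F2)
  qed
qed

lemma invertible_signed_perm: "signed_perm \<sigma> \<Longrightarrow> invertible (\<lambda>x. [\<sigma> x])"
proof -
  assume \<sigma>: "signed_perm \<sigma>"
  obtain \<rho> where \<rho>: "signed_perm \<rho>" "\<And>w. map \<sigma> (map \<rho> w) = w" "\<And>w. map \<rho> (map \<sigma> w) = w"
    using signed_perm_inverse[OF \<sigma>] by blast
  have "red w = []" if "red (map \<sigma> w) = []" for w
  proof -
    have "red (map \<rho> (map \<sigma> w)) = red (map \<rho> [])"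
      unfolding map_subst[of \<rho>] using that by (intro red_subst_cong inv_compat_map \<rho>) simp
    then show ?thesis unfolding \<rho>(3) by simp
  qed
  moreover have "\<exists>w. red (map \<sigma> w) = [x]" for x
    using \<rho>(2)[of "[x]"] by (intro exI[of _ "map \<rho> [x]"]) simp
  ultimately show ?thesis
    using inv_compat_map[OF \<sigma>] by (simp add: invertible_def reduced_Cons)
qed

lemma minimal_map:
  assumes w: "minimal w" and \<sigma>: "signed_perm \<sigma>" shows "minimal (map \<sigma> w)"
  unfolding minimal_def
proof (intro conjI ballI)
  let ?\<sigma> = "\<lambda>w\<in>carrier F2. red (subst (\<lambda>x. [\<sigma> x]) w)"
  have r: "reduced w" using w by (simp add: minimal_def carrier_F2)
  then show "map \<sigma> w \<in> carrier F2" by (simp add: carrier_F2 reduced_map \<sigma>)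
  fix \<phi> assume \<phi>: "\<phi> \<in> auto F2"
  have s: "?\<sigma> \<in> auto F2" by (intro auto_of_invertible invertible_signed_perm \<sigma>)
  have "\<phi> \<otimes>\<^bsub>BijGroup (carrier F2)\<^esub> \<psi> = compose (carrier F2) \<phi> \<psi>"
    if "\<psi> \<in> auto F2" for \<psi>
    using \<phi> that by (simp add: BijGroup_def auto_def)
  then have "compose (carrier F2) \<phi> ?\<sigma> \<in> auto F2"
    using subgroup.m_closed[OF group.subgroup_auto[OF group_F2] \<phi> s] s by metis
  moreover have "?\<sigma> w = map \<sigma> w" using r by (simp add: carrier_F2 red_reduced reduced_map \<sigma>)
  ultimately show "length (map \<sigma> w) \<le> length (\<phi> (map \<sigma> w))"
    using w r unfolding minimal_def by (auto simp: compose_def carrier_F2 dest!: bspec)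
qed

text \<open>The automorphism used for comparison is \<open>a \<mapsto> ab\<close> followed by the conjugation that turns
  the image of \<open>w\<close> into \<open>nielsen_cyclic w\<close>.\<close>

lemma minimal_sym_count_le:
  assumes w: "minimal w" shows "2 * sym_count [A, B_inv] w \<le> num_a w"
proof -
  have r: "reduced w" using w by (simp add: minimal_def carrier_F2)
  obtain g where g: "red (nielsen_cyclic w) = red (g @ subst nielsen w @ word_inv g)"
    using conjugate_nielsen_cyclic[of w] by (auto simp: conjugate_def)
  have id: "signed_perm id" by (simp add: signed_perm_def)
  let ?f = "nielsen_move g id (\<lambda>x. [x])"
  have i: "invertible (\<lambda>x. [x])" using invertible_signed_perm[OF id] by simp
  have "(\<lambda>w\<in>carrier F2. red (subst ?f w)) \<in> auto F2"
    by (intro auto_of_invertible invertible_nielsen_move i id)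
  then have "length w \<le> length (red (subst ?f w))"
    using w r unfolding minimal_def by (auto simp: carrier_F2 dest!: bspec)
  also have "red (subst ?f w) = red (nielsen_cyclic w)"
    using i by (subst red_nielsen_move) (auto simp: g invertible_def)
  finally have "length w \<le> length (nielsen_cyclic w)" using length_red le_trans by blast
  then show ?thesis using length_nielsen_cyclic[of w] by linarith
qed

lemma minimal_iff_locally_minimal:
  assumes "w \<in> C2" shows "minimal w \<longleftrightarrow> locally_minimal w"
proof
  assume m: "minimal w"
  have f: "minimal (map flip_b w)" and s: "minimal (map swap w)"
    and sf: "minimal (map swap (map flip_b w))"
    by (intro minimal_map m signed_perm_flip_b signed_perm_swap)+
  show "locally_minimal w"
    using minimal_sym_count_le[OF m] minimal_sym_count_le[OF f] minimal_sym_count_le[OF s]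
      minimal_sym_count_le[OF sf] assms
    unfolding locally_minimal_def outward_def count_swap count_flip_b
    by (simp add: C2_map)
next
  assume l: "locally_minimal w"
  have r: "reduced w" using assms by (rule C2_reduced)
  have "length w \<le> length (\<phi> w)" if "\<phi> \<in> auto F2" for \<phi>
    using orbit_length[OF orbit_invertible[OF invertible_of_auto(1)[OF that]] l]
      invertible_of_auto(2)[OF that r] by simp
  then show "minimal w" by (simp add: minimal_def carrier_F2 r)
qed

definition excess :: "letter list \<Rightarrow> int" where
  "excess w = \<bar>int (sym_count [A, B] w) - int (sym_count [A, B_inv] w)\<bar>"

text \<open>By \<open>num_eq\<close>, the bounds \<open>2 (ab\<^sup>-\<^sup>1) \<le> num_a\<close> and \<open>2 (ab) \<le> num_a\<close> read
  \<open>\<plusminus>((ab) - (ab\<^sup>-\<^sup>1)) \<le> (aa)\<close>, and similarly for \<open>b\<close>. For a single letter all counts vanish.\<close>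

lemma minimal_iff_excess:
  assumes "w \<in> C2"
  shows "minimal w \<longleftrightarrow> excess w \<le> int (sym_count [A, A] w) \<and> excess w \<le> int (sym_count [B, B] w)"
proof (cases "length w = 1")
  case True
  then show ?thesis
    unfolding minimal_iff_locally_minimal[OF assms] locally_minimal_def outward_def count_flip_b
    using assms by (simp add: C2_map excess_def)
next
  case False
  show ?thesis
    unfolding minimal_iff_locally_minimal[OF assms] locally_minimal_def outward_def count_flip_b
      num_eq[OF assms False] excess_def
    using assms by (simp add: C2_map) linarith
qed

section \<open>Children and root words\<close>

lemma sym_count_rotate_append: "sym_count [x, y] (u @ v) = sym_count [x, y] (v @ u)"
  using sym_count_rotate[of x y "length u" "u @ v"] by (simp add: rotate_append)

text \<open>The cyclic word gains the adjacent pair \<open>cc\<close>, and all other pairs stay. The premise excludes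
  \<open>[c]\<close>, whose only letter is not counted as adjacent to itself.\<close>

lemma sym_count_duplicate:
  assumes "u @ v \<noteq> []"
  shows "sym_count [x, y] (u @ c # c # v) =
    sym_count [x, y] (u @ c # v) + (if x = y \<and> c \<in> {x, bar x} then 1 else 0)"
proof -
  let ?t = "v @ u"
  have t: "length (c # ?t) \<noteq> 1" "length (c # c # ?t) \<noteq> 1" using assms by auto
  have "cyc_pairs (c # c # ?t) = (c, c) # cyc_pairs (c # ?t)" by (simp add: cyc_pairs_def)
  then have "sym_count [x, y] (c # c # ?t) =
      sym_count [x, y] (c # ?t) + (if x = y \<and> c \<in> {x, bar x} then 1 else 0)"
    using sym_count_pair[of "c # ?t" x y] sym_count_pair[of "c # c # ?t" x y] t by auto
  then show ?thesis
    using sym_count_rotate_append[of x y u "c # c # v"] sym_count_rotate_append[of x y u "c # v"] by simp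
qed

lemma C2_duplicate:
  assumes "u @ c # c # v \<in> C2" shows "u @ c # v \<in> C2"
proof -
  have "(c # c # v) @ u \<in> C2" using assms by (rule C2_append_swap)
  then have "(c # v) @ u \<in> C2" by (auto simp: C2_def reduced_Cons split: if_splits)
  then show ?thesis by (rule C2_append_swap)
qed

lemma is_child_iff:
  "is_child w u \<longleftrightarrow> (u = [] \<and> (\<exists>x. w = [x])) \<or>
     (\<exists>l c r. u = l @ c # r \<and> w = l @ c # c # r \<and> u \<in> C2)"
proof -
  have "(\<exists>i<length u. w = take (Suc i) u @ drop i u) \<longleftrightarrow> (\<exists>l c r. u = l @ c # r \<and> w = l @ c # c # r)"
  proof
    assume "\<exists>i<length u. w = take (Suc i) u @ drop i u"
    then obtain i where i: "i < length u" "w = take (Suc i) u @ drop i u" by blast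
    then show "\<exists>l c r. u = l @ c # r \<and> w = l @ c # c # r"
      by (intro exI[of _ "take i u"] exI[of _ "u ! i"] exI[of _ "drop (Suc i) u"])
        (simp add: take_Suc_conv_app_nth id_take_nth_drop[symmetric] Cons_nth_drop_Suc)
  next
    assume "\<exists>l c r. u = l @ c # r \<and> w = l @ c # c # r"
    then obtain l c r where "u = l @ c # r" "w = l @ c # c # r" by blast
    then show "\<exists>i<length u. w = take (Suc i) u @ drop i u"
      by (intro exI[of _ "length l"]) simp
  qed
  then show ?thesis unfolding is_child_def by auto
qed

lemma minimal_single: "minimal [x]"
  using single_letter(1)[of x] by (simp add: minimal_iff_excess excess_def)

lemma not_balanced_square: "\<not> balanced A B [c, c]"
  by (cases c) (simp_all add: balanced_def sym_count_pair cyc_pairs_def)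

text \<open>A parent of length at least two has the same excess but a smaller \<open>(aa)\<close> or \<open>(bb)\<close>, which drops
  below the excess; so the parent is not minimal. A parent with one letter has the square of a letter
  as its child, which is not balanced.\<close>

lemma balanced_root_word:
  assumes w: "w \<in> C2" "length w \<noteq> 1" and b: "balanced A B w"
  shows "root_word w"
proof -
  have b': "excess w = int (sym_count [A, A] w)" "sym_count [A, A] w = sym_count [B, B] w"
    using b by (simp_all add: balanced_def excess_def)
  have False if u: "minimal u" "is_child w u" for u
  proof -
    from u(2) w(2) obtain l c r where *: "u = l @ c # r" "w = l @ c # c # r" "u \<in> C2"
      unfolding is_child_iff by auto
    show False
    proof (cases "l @ r = []")
      case True
      then show False using b not_balanced_square[of c] * by simp
    next
      case False
      note d = sym_count_duplicate[OF False, of _ _ c, folded *(1,2)]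
      have e: "excess w = excess u" using d[of A B] d[of A B_inv] by (simp add: excess_def)
      have "excess u \<le> int (sym_count [A, A] u)" "excess u \<le> int (sym_count [B, B] u)"
        using u(1) minimal_iff_excess[OF *(3)] by auto
      then show False using b' e d[of A A] d[of B B] by (cases c) simp_all
    qed
  qed
  moreover have "minimal w" using b' by (simp add: minimal_iff_excess[OF w(1)])
  ultimately show ?thesis by (auto simp: root_word_def)
qed

text \<open>A minimal word that is not balanced has one of \<open>(aa), (bb)\<close> strictly above the excess, hence
  positive.\<close>

lemma unbalanced_repetition:
  assumes w: "w \<in> C2" "minimal w" and b: "\<not> balanced A B w"
  obtains z c where "z \<in> {A, B}" "c \<in> {z, bar z}" "excess w < int (sym_count [z, z] w)"
    "(c, c) \<in> set (cyc_pairs w)" "length w \<noteq> 1"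
proof -
  have "\<exists>z\<in>{A, B}. excess w < int (sym_count [z, z] w)"
    using b w(2) unfolding minimal_iff_excess[OF w(1)]
    by (auto simp: balanced_def excess_def)
  then obtain z where z: "z \<in> {A, B}" "excess w < int (sym_count [z, z] w)" by blast
  have "0 \<le> excess w" by (simp add: excess_def)
  then have pos: "sym_count [z, z] w \<noteq> 0" using z(2) by linarith
  then have l: "length w \<noteq> 1" using sym_count_single by metis
  then have "count_list (cyc_pairs w) (z, z) \<noteq> 0 \<or> count_list (cyc_pairs w) (bar z, bar z) \<noteq> 0"
    using pos by (auto simp: sym_count_pair)
  then have "\<exists>c\<in>{z, bar z}. (c, c) \<in> set (cyc_pairs w)" by (auto simp: count_list_0_iff)
  then show ?thesis using that z l by blast
qed

lemma repetition_not_root_word: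
  assumes w: "l @ c # c # r \<in> C2" "minimal (l @ c # c # r)"
    and z: "z \<in> {A, B}" "c \<in> {z, bar z}" "excess (l @ c # c # r) < int (sym_count [z, z] (l @ c # c # r))"
  shows "\<not> root_word (l @ c # c # r)"
proof -
  let ?u = "l @ c # r"
  have u: "?u \<in> C2" using w(1) by (rule C2_duplicate)
  have "minimal ?u"
  proof (cases "l @ r = []")
    case True
    then show ?thesis by (simp add: minimal_single)
  next
    case False
    note d = sym_count_duplicate[OF False, of _ _ c]
    have e: "excess (l @ c # c # r) = excess ?u" using d[of A B] d[of A B_inv] by (simp add: excess_def)
    show ?thesis
      using w(2) z d[of A A] d[of B B] unfolding minimal_iff_excess[OF w(1)] minimal_iff_excess[OF u] e
      by auto
  qed
  moreover have "is_child (l @ c # c # r) ?u" unfolding is_child_iff using u by blast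
  ultimately show ?thesis by (auto simp: root_word_def)
qed

text \<open>The repetition might consist of the last and the first letter of \<open>w\<close>, where it is invisible to
  children; this is where the distinct end letters enter.\<close>

lemma root_word_balanced:
  assumes w: "w \<in> C2" "w = [] \<or> hd w \<noteq> last w" and root: "root_word w"
  shows "balanced A B w"
proof (rule ccontr)
  assume b: "\<not> balanced A B w"
  have m: "minimal w" using root by (simp add: root_word_def)
  obtain z c where z: "z \<in> {A, B}" "c \<in> {z, bar z}" "excess w < int (sym_count [z, z] w)"
    and cc: "(c, c) \<in> set (cyc_pairs w)"
    using unbalanced_repetition[OF w(1) m b] by metis
  obtain i where i: "i < length w" "w ! i = c" "rotate1 w ! i = c"
    using cc by (auto simp: cyc_pairs_def set_zip)
  have "w \<noteq> []" using i by auto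
  have "Suc i < length w"
  proof (rule ccontr)
    assume "\<not> ?thesis"
    then have "Suc i = length w" using i(1) by simp
    then have "length w - 1 = i" "rotate1 w ! i = w ! 0" using i(1) by (simp_all add: nth_rotate1)
    then have "last w = c" "hd w = c"
      using i(2,3) \<open>w \<noteq> []\<close> by (simp_all add: last_conv_nth hd_conv_nth)
    then show False using w(2) \<open>w \<noteq> []\<close> by simp
  qed
  then have "drop (Suc i) w = w ! Suc i # drop (Suc (Suc i)) w" "w ! Suc i = c"
    using i Cons_nth_drop_Suc[of "Suc i" w] by (simp_all add: nth_rotate1)
  then have "w = take i w @ c # c # drop (Suc (Suc i)) w"
    using id_take_nth_drop[OF i(1)] i(2) by metis
  then show False using repetition_not_root_word[of "take i w" c "drop (Suc (Suc i)) w" z] z w(1) m root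
    by metis
qed

text \<open>Some rotation of \<open>w\<close> begins with the repeated letter.\<close>

lemma rotations_root_word_balanced:
  assumes w: "w \<in> C2" and root: "\<And>n. root_word (rotate n w)"
  shows "balanced A B w"
proof (rule ccontr)
  assume b: "\<not> balanced A B w"
  have m: "minimal (rotate n w)" for n using root by (simp add: root_word_def)
  obtain z c where z: "z \<in> {A, B}" "c \<in> {z, bar z}" "excess w < int (sym_count [z, z] w)"
    and cc: "(c, c) \<in> set (cyc_pairs w)" and l: "length w \<noteq> 1"
    using unbalanced_repetition[OF w m[of 0, simplified] b] by metis
  obtain i where i: "i < length w" "w ! i = c" "rotate1 w ! i = c"
    using cc by (auto simp: cyc_pairs_def set_zip)
  have two: "Suc 0 < length w" using i(1) l by linarith
  have "rotate i w ! 0 = c" "rotate i w ! Suc 0 = c"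
    using i two nth_rotate[of 0 w i] nth_rotate[of "Suc 0" w i]
    by (cases "w = []"; simp add: nth_rotate1)+
  moreover have "length (rotate i w) > Suc 0" using two by simp
  ultimately obtain r where r: "rotate i w = [] @ c # c # r"
    by (cases "rotate i w"; cases "tl (rotate i w)") auto
  have "excess (rotate i w) < int (sym_count [z, z] (rotate i w))" using z(3) by (simp add: excess_def)
  then have "\<not> root_word (rotate i w)"
    using repetition_not_root_word[of "[]" c r z] z C2_rotate[OF w, of i] m[of i] unfolding r by simp
  then show False using root by simp
qed

lemma balanced_iff:
  assumes w: "w \<in> C2" and xy: "x \<notin> {y, bar y}"
  shows "balanced y x w \<longleftrightarrow> balanced A B w"
proof -
  note i = sym_count_word_inv[of _ _ w]
  have "sym_count [A_inv, A_inv] w = sym_count [A, A] w" "sym_count [B_inv, B_inv] w = sym_count [B, B] w"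
    "sym_count [B_inv, A_inv] w = sym_count [A, B] w" "sym_count [B, A_inv] w = sym_count [A, B_inv] w"
    "sym_count [A_inv, B_inv] w = sym_count [A, B] w" "sym_count [A_inv, B] w = sym_count [A, B_inv] w"
    using i[of A A] i[of B B] i[of B A] i[of A B] i[of B_inv A] i[of A B_inv] sym_count_swap[OF w] by simp_all
  then show ?thesis
    using xy sym_count_swap[OF w] by (cases x; cases y) (auto simp: balanced_def abs_minus_commute)
qed

theorem theorem7:
  fixes w :: "letter list"
  assumes "w \<in> C2"
  shows "(w = [] \<or> hd w \<noteq> last w \<longrightarrow> (root_word w \<longleftrightarrow> balanced A B w)) \<and>
         (length w \<noteq> 1 \<longrightarrow> ((\<forall>n. root_word (rotate n w)) \<longleftrightarrow> balanced A B w)) \<and>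
         (balanced A B w \<longleftrightarrow> (\<exists>x y. x \<notin> {y, bar y} \<and> balanced y x w))"
proof (intro conjI impI)
  assume h: "w = [] \<or> hd w \<noteq> last w"
  then have "length w \<noteq> 1" by (auto simp: length_Suc_conv)
  then show "root_word w \<longleftrightarrow> balanced A B w"
    using balanced_root_word root_word_balanced assms h by blast
next
  assume l: "length w \<noteq> 1"
  have "root_word (rotate n w)" if "balanced A B w" for n
    using that l by (intro balanced_root_word C2_rotate assms) (simp_all add: balanced_def)
  then show "(\<forall>n. root_word (rotate n w)) \<longleftrightarrow> balanced A B w"
    using rotations_root_word_balanced[OF assms] by blast
next
  have "B \<notin> {A, bar A}" by simp
  then show "balanced A B w \<longleftrightarrow> (\<exists>x y. x \<notin> {y, bar y} \<and> balanced y x w)"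
    using balanced_iff[OF assms] by metis
qed

end
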